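(* Let $\delta_0>0$ and assume $\lambda\ge\mu$. There exists a constant $C>0$, depending on $\Omega$ and $\delta_0$, such that for any $\delta\in(0,\delta_0]$ and every $\bm{u}\in S(\square\cap\Omega;\mathbb{R}^d)$, $$|r^h_\Omega(-\mathcal{L}^{S,h}_\delta \bm{u})|_h\ \ge\ C\,\|\bm{u}\|_{L^2(\mathbb{R}^d;\mathbb{R}^d)}.$$
   Context: Let $d\in\{2,3\}$ and let $\Omega\subset\mathbb{R}^d$ be open and bounded. The dimension $d$, the Lamé parameters $\lambda,\mu$ (constants, $\mu>0$), the kernel $\rho$ and the vector $\hat{\bm h}$ below are fixed data. Kernel: $\rho(|\bm s|)\ge 0$ is non-increasing in $|\bm s|$, supported in the unit ball $B_1$, with $\int_{B_1}\rho(|\bm s|)|\bm s|^2d\bm s=d$. For $\delta>0$ put $\rho_\delta(|\bm s|)=\delta^{-(d+2)}\rho(|\bm s|/\delta)$, and let $B_\delta$ be the ball of radius $\delta$ centered at $\bm 0$. Nonlocal operators (functions on $\mathbb{R}^d$; functions with zero volumetric constraint are extended by zero): $\mathcal{L}^B_\delta \bm u(\bm x)=\int_{B_\delta}\rho_\delta(|\bm s|)\frac{\bm s\otimes\bm s}{|\bm s|^2}(\bm u(\bm x+\bm s)-\bm u(\bm x))d\bm s$, $\mathcal{D}_\delta\bm u(\bm x)=\int_{B_\delta}\rho_\delta(|\bm s|)\,\bm s\cdot(\bm u(\bm x+\bm s)-\bm u(\bm x))d\bm s$, $\mathcal{G}_\delta\theta(\bm x)=\int_{B_\delta}\rho_\delta(|\bm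 s|)\,\bm s\,(\theta(\bm x+\bm s)-\theta(\bm x))d\bm s$. Constants: $C_\alpha=30,\ C_\beta=3$ if $d=3$; $C_\alpha=16,\ C_\beta=2$ if $d=2$. Grid: $\bm h=(h_1,\dots,h_d)=h_{\max}\hat{\bm h}$ with $h_j>0$, $h_{\max}=\max_jh_j$, where $\hat{\bm h}$ is a fixed vector with maximum component $1$ and components bounded below by a positive constant. $\square=\{\bm x_{\bm k}=(k_1h_1,\dots,k_dh_d):\bm k\in\mathbb{Z}^d\}$. RK (reproducing kernel) basis: $\Psi_{\bm k}(\bm x)=\prod_{j=1}^d\phi(|x_j-k_jh_j|/(2h_j))$, where $\phi(x)=\frac23-4x^2+4x^3$ for $0\le x\le\frac12$, $\phi(x)=\frac43(1-x)^3$ for $\frac12\le x\le1$, and $\phi(x)=0$ otherwise. For a sequence $(u_{\bm k})$, $i^h(u_{\bm k})=\sum_{\bm k\in\mathbb{Z}^d}\Psi_{\bm k}u_{\bm k}$; for continuous $u$, $r^hu=(u(\bm x_{\bm k}))_{\bm k\in\mathbb{Z}^d}$ and $\Pi^h=i^hr^h$; all act componentwise on vector-valued objects. $r^h_\Omega u=(u(\bm x_{\bm k}))_{\bm x_{\bm k}\in\square\cap\Omega}$. $S(\square\cap\Omega;\mathbb{R}^d)$ is the space of functions $i^h(\bm u_{\bm k})$ with $\bm u_{\bm k}\in\mathbb{R}^d$ and $\bm u_{\bm k}=\bm 0$ whenever $\bm x_{\bm k}\notin\Omega$. Discrete norm: $|(\bm u_{\bm k})|_h=\|i^h(\bm u_{\bm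 k})\|_{L^2(\mathbb{R}^d;\mathbb{R}^d)}$, where sequences indexed by a subset of $\mathbb{Z}^d$ are extended by zero. For $\bm v$ in the trial space, $\mathcal{L}^{S,h}_\delta\bm v=\frac{C_\alpha\mu}{d}\mathcal{L}^B_\delta\bm v+\frac{C_\beta(\lambda-\mu)}{d}\mathcal{G}_\delta\Pi^h(\mathcal{D}_\delta\bm v)$ (the RK interpolation is applied also to the dilatation).
   Formalization: The mesh size is restricted to h_max ≤ h_0 for an arbitrary h_0 > 0, and C may also depend on h_0; uniformity over all h_max fails, e.g. on the unit ball with u = Ψ_0 e as h_max → ∞. *)

theory Defs
  imports "HOL-Analysis.Analysis"
begin

section \<open>Nonlocal operators\<close>

definition kernel_scaled :: "(real \<Rightarrow> real) \<Rightarrow> real \<Rightarrow> real^'n \<Rightarrow> real" where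
  "kernel_scaled \<rho> \<delta> s = \<rho> (norm s / \<delta>) / \<delta> ^ (CARD('n) + 2)"

text \<open>
  The factor \<open>((s \<bullet> w) / |s|^2) s\<close> is \<open>(s \<otimes> s) w / |s|^2\<close>.  The kernel is only required to
  satisfy \<open>\<integral> \<rho>(|s|) |s|^2 ds < \<infinity>\<close>, so the integrand, which is of order \<open>\<rho>(|s|) |s|\<close> near the
  origin for smooth \<open>u\<close>, need not be absolutely integrable.  The integral is therefore a
  principal value, which coincides with the Lebesgue integral whenever the latter exists.
  In the operators \<open>nl_div\<close> and \<open>nl_grad\<close> the integrand is of order \<open>\<rho>(|s|) |s|^2\<close>, so no
  principal value is needed for Lipschitz arguments.
\<close>

definition nl_bond ::
  "(real \<Rightarrow> real) \<Rightarrow> real \<Rightarrow> (real^'n \<Rightarrow> real^'n) \<Rightarrow> real^'n \<Rightarrow> real^'n" where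
  "nl_bond \<rho> \<delta> u x =
     Lim (at_right 0) (\<lambda>\<epsilon>. LINT s:(ball 0 \<delta> - ball 0 \<epsilon>)|lborel.
       kernel_scaled \<rho> \<delta> s *\<^sub>R (((s \<bullet> (u (x + s) - u x)) / (norm s)\<^sup>2) *\<^sub>R s))"

definition nl_div ::
  "(real \<Rightarrow> real) \<Rightarrow> real \<Rightarrow> (real^'n \<Rightarrow> real^'n) \<Rightarrow> real^'n \<Rightarrow> real" where
  "nl_div \<rho> \<delta> u x =
     (LINT s:ball 0 \<delta>|lborel. kernel_scaled \<rho> \<delta> s * (s \<bullet> (u (x + s) - u x)))"

definition nl_grad ::
  "(real \<Rightarrow> real) \<Rightarrow> real \<Rightarrow> (real^'n \<Rightarrow> real) \<Rightarrow> real^'n \<Rightarrow> real^'n" where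
  "nl_grad \<rho> \<delta> \<theta> x =
     (LINT s:ball 0 \<delta>|lborel. (kernel_scaled \<rho> \<delta> s * (\<theta> (x + s) - \<theta> x)) *\<^sub>R s)"

text \<open>Only the dimensions 2 and 3 are meaningful.\<close>

definition C_alpha :: "nat \<Rightarrow> real" where
  "C_alpha d = (if d = 3 then 30 else 16)"

definition C_beta :: "nat \<Rightarrow> real" where
  "C_beta d = (if d = 3 then 3 else 2)"

section \<open>Grid and reproducing kernel interpolation\<close>

definition grid_point :: "real^'n \<Rightarrow> int^'n \<Rightarrow> real^'n" where
  "grid_point h k = (\<chi> j. of_int (k $ j) * h $ j)"

definition rk_phi :: "real \<Rightarrow> real" where
  "rk_phi x =
     (if 0 \<le> x \<and> x \<le> 1/2 then 2/3 - 4 * x^2 + 4 * x^3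
      else if 1/2 \<le> x \<and> x \<le> 1 then 4/3 * (1 - x)^3
      else 0)"

definition rk_basis :: "real^'n \<Rightarrow> int^'n \<Rightarrow> real^'n \<Rightarrow> real" where
  "rk_basis h k x =
     (\<Prod>j\<in>UNIV. rk_phi (\<bar>x $ j - of_int (k $ j) * h $ j\<bar> / (2 * h $ j)))"

text \<open>At each point only finitely many terms of the sum are nonzero.\<close>

definition rk_interp ::
  "real^'n \<Rightarrow> (int^'n \<Rightarrow> 'b::real_normed_vector) \<Rightarrow> real^'n \<Rightarrow> 'b" where
  "rk_interp h U x = (\<Sum>\<^sub>\<infinity>k\<in>UNIV. rk_basis h k x *\<^sub>R U k)"

definition grid_restrict :: "real^'n \<Rightarrow> (real^'n \<Rightarrow> 'b) \<Rightarrow> int^'n \<Rightarrow> 'b" where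
  "grid_restrict h u k = u (grid_point h k)"

text \<open>Restriction to the grid points in \<open>\<Omega>\<close>, already extended by zero to all indices.\<close>

definition grid_restrict_on ::
  "real^'n \<Rightarrow> (real^'n) set \<Rightarrow> (real^'n \<Rightarrow> 'b::zero) \<Rightarrow> int^'n \<Rightarrow> 'b" where
  "grid_restrict_on h \<Omega> u k = (if grid_point h k \<in> \<Omega> then u (grid_point h k) else 0)"

definition rk_proj ::
  "real^'n \<Rightarrow> (real^'n \<Rightarrow> 'b::real_normed_vector) \<Rightarrow> real^'n \<Rightarrow> 'b" where
  "rk_proj h u = rk_interp h (grid_restrict h u)"

definition trial_space ::
  "real^'n \<Rightarrow> (real^'n) set \<Rightarrow> (real^'n \<Rightarrow> real^'n) set" where
  "trial_space h \<Omega> = {rk_interp h U | U. \<forall>k. grid_point h k \<notin> \<Omega> \<longrightarrow> U k = 0}"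

definition L2_norm :: "(real^'n \<Rightarrow> 'b::real_normed_vector) \<Rightarrow> real" where
  "L2_norm f = sqrt (LINT x|lborel. (norm (f x))\<^sup>2)"

definition discrete_norm ::
  "real^'n \<Rightarrow> (int^'n \<Rightarrow> 'b::real_normed_vector) \<Rightarrow> real" where
  "discrete_norm h U = L2_norm (rk_interp h U)"

definition nl_navier_rk ::
  "real \<Rightarrow> real \<Rightarrow> (real \<Rightarrow> real) \<Rightarrow> real \<Rightarrow> real^'n \<Rightarrow>
     (real^'n \<Rightarrow> real^'n) \<Rightarrow> real^'n \<Rightarrow> real^'n" where
  "nl_navier_rk lam \<mu> \<rho> \<delta> h v x =
     (C_alpha CARD('n) * \<mu> / real CARD('n)) *\<^sub>R nl_bond \<rho> \<delta> v x
     + (C_beta CARD('n) * (lam - \<mu>) / real CARD('n)) *\<^sub>R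
         nl_grad \<rho> \<delta> (rk_proj h (nl_div \<rho> \<delta> v)) x"

end

theory Submission
  imports Defs
begin

text \<open>
  The cubic B-spline is the convolution of two hat functions, so the values of the spline function
  with coefficients \<open>U\<close> at shifted grid points are correlations of the hat interpolant \<open>w\<close> of \<open>U\<close>,
  and the quadratic form of the collocation operator \<open>nl_bond\<close> on coefficient sequences is a
  Galerkin form for \<open>w\<close>.  For a fixed bond vector \<open>s\<close> only the scalar sequence \<open>s \<bullet> U k\<close> enters;
  since its hat interpolant has bounded support, telescoping about \<open>D / |s|\<close> steps of length \<open>|s|\<close>
  bounds its \<open>L\<^sup>2\<close> norm by \<open>D / |s|\<close> times that of a single increment.  This is a nonlocal Poincare inequality
  with explicit dependence on \<open>|s|\<close>, and integrating it against the kernel gives coercivity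
  uniformly in \<open>\<delta>\<close>, because the second moments of the scaled kernel do not depend on \<open>\<delta>\<close>.
  On grid values \<open>nl_div\<close> and \<open>nl_grad\<close> are given by the same odd coefficients, so the dilatation
  term contributes a nonnegative sum of squares.  Coefficient norms and \<open>L\<^sup>2\<close> norms are compared by
  means of dual functions supported in a single cell.
\<close>

section \<open>One-dimensional splines\<close>

text \<open>Pairing the interpolated residual with \<open>u\<close> in L2 would put the spline mass
  matrix between the two coefficient sequences, and definiteness of that product is not evident. The
  residual at the grid points is therefore summed directly against the coefficients
  \<open>U k\<close>; Young's inequality then turns coercivity into a lower bound for the residual.
  On squares the telescoping estimate loses the factor (D / |s|)^2. The weight 1 / |s|^2 in
  \<open>nl_bond\<close> compensates exactly this and leaves the kernel times (s \<bullet> U k)^2.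
  Its integral controls |U k|^2, because the kernel cannot be concentrated on a hyperplane. Two
  kinds of constants must be kept apart. Lipschitz and second difference bounds of the splines blow
  up with the mesh, but they serve only to make integrals exist and to remove the principal value.
  The constants of the estimate itself see the mesh only through the bound \<open>h\<^sub>0\<close>,
  which enters D, a shift length beyond which the correlations of the hat interpolant
  vanish.\<close>

definition tent :: "real \<Rightarrow> real" where
  "tent t = max 0 (1 - \<bar>t\<bar>)"

text \<open>The centred cubic B-spline with support [-2, 2]. The halving undoes the 2 h_j in
  \<open>rk_basis\<close>, so that the basis functions become integer translates in the variables
  x_j / h_j.\<close>

definition cubic_spline :: "real \<Rightarrow> real" where
  "cubic_spline t = rk_phi (\<bar>t\<bar> / 2)"

text \<open>
  The polynomials of degree 1 and 3 on the unit cell dual to \<open>tent\<close> and \<open>cubic_spline\<close>: orthogonal there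
  to all integer translates but the centred one, with which the inner product is 1.
\<close>

definition tent_dual :: "real \<Rightarrow> real" where
  "tent_dual t = (if 0 \<le> t \<and> t < 1 then 4 - 6 * t else 0)"

definition spline_dual :: "real \<Rightarrow> real" where
  "spline_dual t = (if 0 \<le> t \<and> t < 1 then 1260 * t ^ 3 - 1920 * t\<^sup>2 + 780 * t - 64 else 0)"

lemma cubic_spline_inner: "\<bar>t\<bar> \<le> 1 \<Longrightarrow> cubic_spline t = 2/3 - t\<^sup>2 + \<bar>t\<bar> ^ 3 / 2"
  by (simp add: cubic_spline_def rk_phi_def field_simps)

lemma cubic_spline_outer: "1 \<le> \<bar>t\<bar> \<Longrightarrow> \<bar>t\<bar> \<le> 2 \<Longrightarrow> cubic_spline t = (2 - \<bar>t\<bar>) ^ 3 / 6"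
proof -
  assume a: "1 \<le> \<bar>t\<bar>" "\<bar>t\<bar> \<le> 2"
  show ?thesis
  proof (cases "\<bar>t\<bar> = 1")
    case True
    then show ?thesis by (simp add: cubic_spline_def rk_phi_def power2_eq_square power3_eq_cube)
  next
    case False
    then show ?thesis using a
      by (simp add: cubic_spline_def rk_phi_def power3_eq_cube field_simps)
  qed
qed

lemma cubic_spline_zero: "2 \<le> \<bar>t\<bar> \<Longrightarrow> cubic_spline t = 0"
  by (cases "\<bar>t\<bar> = 2") (auto simp add: cubic_spline_def rk_phi_def)

lemma cubic_spline_minus: "cubic_spline (- t) = cubic_spline t"
  by (simp add: cubic_spline_def)

lemma cubic_spline_range: "0 \<le> cubic_spline t" "cubic_spline t \<le> 2/3"
proof -
  define r where "r = \<bar>t\<bar>"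
  have r0: "0 \<le> r" by (simp add: r_def)
  have c: "cubic_spline t = cubic_spline r" by (simp add: r_def cubic_spline_def)
  consider "r \<le> 1" | "1 \<le> r" "r \<le> 2" | "2 \<le> r" by linarith
  then have "0 \<le> cubic_spline r \<and> cubic_spline r \<le> 2/3"
  proof cases
    case 1
    have e: "cubic_spline r = 2/3 - r\<^sup>2 * (1 - r / 2)"
      using 1 r0 by (simp add: cubic_spline_inner power2_eq_square power3_eq_cube field_simps)
    have "r\<^sup>2 * (1 - r / 2) \<le> 1/2"
    proof -
      \<comment> \<open>The product expands to 1 - 2 r^2 + r^3, twice the gap in the claimed
        bound.\<close>
      have "0 \<le> (1 - r) * (1 + r - r\<^sup>2)" using 1 r0
        by (intro mult_nonneg_nonneg) (auto simp: power2_eq_square intro: add_increasing mult_left_le)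
      then show ?thesis by (simp add: power2_eq_square field_simps)
    qed
    moreover have "0 \<le> r\<^sup>2 * (1 - r / 2)" using 1 r0 by auto
    ultimately show ?thesis using e by linarith
  next
    case 2
    have "cubic_spline r = (2 - r) ^ 3 / 6" using 2 by (simp add: cubic_spline_outer)
    moreover have "(2 - r) ^ 3 \<le> 1" using power_mono[of "2 - r" 1 3] 2 by simp
    moreover have "0 \<le> (2 - r) ^ 3" using 2 by (intro zero_le_power) auto
    ultimately show ?thesis by linarith
  next
    case 3 then show ?thesis using r0 by (simp add: cubic_spline_zero)
  qed
  then show "0 \<le> cubic_spline t" "cubic_spline t \<le> 2/3" using c by auto
qed

text \<open>Quadratic flatness at the centre is the only smoothness estimate proved by hand;
  positive definiteness later carries it to all other points, as in
  \<open>psi_second_difference\<close>.\<close>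

lemma cubic_spline_drop: "cubic_spline 0 - cubic_spline t \<le> t\<^sup>2"
proof (cases "\<bar>t\<bar> \<le> 1")
  case True
  then show ?thesis by (simp add: cubic_spline_inner)
next
  case False
  then have "1 \<le> t\<^sup>2" using abs_le_square_iff[of 1 t] by simp
  then show ?thesis using cubic_spline_range[of t] cubic_spline_range[of 0] by linarith
qed

text \<open>A class closed under products, shifts and finite sums in which integrability is
  automatic. Continuity is not demanded, since the dual functions jump at the ends of their
  cell.\<close>

definition test_fun :: "('a::real_normed_vector \<Rightarrow> real) \<Rightarrow> bool" where
  "test_fun f \<longleftrightarrow> f \<in> borel_measurable borel \<and> (\<exists>M. \<forall>x. \<bar>f x\<bar> \<le> M) \<and> (\<exists>R. \<forall>x. R < norm x \<longrightarrow> f x = 0)"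

lemma test_fun_integrable:
  fixes f :: "'a::euclidean_space \<Rightarrow> real"
  assumes "test_fun f" shows "integrable lborel f"
proof -
  obtain M R where f: "f \<in> borel_measurable borel" and M: "\<And>x. \<bar>f x\<bar> \<le> M" and R: "\<And>x. R < norm x \<Longrightarrow> f x = 0"
    using assms unfolding test_fun_def by blast
  show ?thesis
  proof (rule integrableI_bounded_set[where A = "cball 0 R" and B = M])
    show "emeasure lborel (cball (0::'a) R) < \<infinity>"
      by (rule emeasure_bounded_finite) simp
  qed (use f M R in \<open>auto simp: mem_cball_0 not_le\<close>)
qed

lemma test_fun_mult: assumes "test_fun f" "test_fun g" shows "test_fun (\<lambda>x. f x * g x)"
proof -
  obtain M R N where f: "f \<in> borel_measurable borel" "g \<in> borel_measurable borel"
    and M: "\<And>x. \<bar>f x\<bar> \<le> M" "\<And>x. \<bar>g x\<bar> \<le> N" and R: "\<And>x. R < norm x \<Longrightarrow> f x = 0"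
    using assms unfolding test_fun_def by blast
  have "\<bar>f x * g x\<bar> \<le> M * N" for x
    using M(1)[of x] M(2)[of x] by (auto simp: abs_mult intro!: mult_mono)
  then show ?thesis using f R unfolding test_fun_def by (auto 4 3)
qed

lemma test_fun_affine:
  fixes f :: "'a::euclidean_space \<Rightarrow> real"
  assumes "test_fun f" "c \<noteq> 0" shows "test_fun (\<lambda>x. f (c *\<^sub>R x - a))"
proof -
  obtain M R where f: "f \<in> borel_measurable borel" and M: "\<And>x. \<bar>f x\<bar> \<le> M" and R: "\<And>x. R < norm x \<Longrightarrow> f x = 0"
    using assms unfolding test_fun_def by blast
  have "f (c *\<^sub>R x - a) = 0" if "(R + norm a) / \<bar>c\<bar> < norm x" for x
  proof (rule R)
    have "R + norm a < \<bar>c\<bar> * norm x" using that assms(2) by (simp add: field_simps)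
    also have "\<dots> \<le> norm (c *\<^sub>R x - a) + norm a"
      using norm_triangle_ineq[of "c *\<^sub>R x - a" a] by simp
    finally show "R < norm (c *\<^sub>R x - a)" by simp
  qed
  moreover have "(\<lambda>x. f (c *\<^sub>R x - a)) \<in> borel_measurable borel"
    using f by measurable
  ultimately show ?thesis using M unfolding test_fun_def by blast
qed

lemma test_fun_tent: "test_fun tent"
  unfolding test_fun_def
proof (intro conjI exI allI impI)
  show "tent \<in> borel_measurable borel" unfolding tent_def[abs_def] by measurable
  show "\<bar>tent x\<bar> \<le> 1" for x by (simp add: tent_def)
  show "tent x = 0" if "1 < norm x" for x using that by (simp add: tent_def)
qed

lemma test_fun_tent_dual: "test_fun tent_dual"
  unfolding test_fun_def
proof (intro conjI exI allI impI)
  show "tent_dual \<in> borel_measurable borel" unfolding tent_dual_def[abs_def] by measurable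
  show "\<bar>tent_dual x\<bar> \<le> 4" for x by (auto simp: tent_dual_def)
  show "tent_dual x = 0" if "1 < norm x" for x using that by (auto simp add: tent_dual_def)
qed

lemma test_fun_cubic_spline: "test_fun cubic_spline"
  unfolding test_fun_def
proof (intro conjI exI allI impI)
  show "cubic_spline \<in> borel_measurable borel"
    unfolding cubic_spline_def[abs_def] rk_phi_def by measurable
  show "\<bar>cubic_spline x\<bar> \<le> 1" for x using cubic_spline_range[of x] by linarith
  show "cubic_spline x = 0" if "2 < norm x" for x using that by (simp add: cubic_spline_zero)
qed

lemma test_fun_spline_dual: "test_fun spline_dual"
  unfolding test_fun_def
proof (intro conjI exI allI impI)
  show "spline_dual \<in> borel_measurable borel" unfolding spline_dual_def[abs_def] by measurable
  show "\<bar>spline_dual t\<bar> \<le> 1260 + 1920 + 780 + 64" for t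
  proof (cases "0 \<le> t \<and> t < 1")
    case True
    then have "t ^ 3 \<le> 1" "t\<^sup>2 \<le> 1" "0 \<le> t ^ 3" "0 \<le> t\<^sup>2" by (simp_all add: power_le_one)
    moreover have "spline_dual t = 1260 * t ^ 3 - 1920 * t\<^sup>2 + 780 * t - 64"
      using True by (simp add: spline_dual_def)
    ultimately show ?thesis using True by linarith
  qed (auto simp: spline_dual_def)
  show "spline_dual x = 0" if "1 < norm x" for x using that by (auto simp add: spline_dual_def)
qed

lemma test_fun_integral_eq:
  fixes f :: "real \<Rightarrow> real"
  assumes "test_fun f" "(f has_integral I) {a..b}" "\<And>x. x \<notin> {a..b} \<Longrightarrow> f x = 0"
  shows "integral\<^sup>L lborel f = I"
proof -
  have "(f has_integral I) UNIV"
    using has_integral_on_superset[OF assms(2) assms(3)] by auto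
  then show ?thesis using has_integral_integral_lborel[OF test_fun_integrable[OF assms(1)]]
    has_integral_unique by blast
qed

lemma has_integral_FTC:
  fixes F :: "real \<Rightarrow> real"
  assumes "a \<le> b" "\<And>x. (F has_real_derivative F' x) (at x)" "\<And>x. a \<le> x \<Longrightarrow> x \<le> b \<Longrightarrow> f x = F' x"
    "F b - F a = I"
  shows "(f has_integral I) {a..b}"
proof -
  have "(F' has_integral F b - F a) {a..b}"
    by (intro fundamental_theorem_of_calculus assms(1))
      (auto simp: has_real_derivative_iff_has_vector_derivative[symmetric]
        intro!: has_field_derivative_at_within assms(2))
  then show ?thesis using assms by (subst has_integral_cong[where g = F']) auto
qed

lemma test_fun_shift: fixes f :: "'a::euclidean_space \<Rightarrow> real" shows "test_fun f \<Longrightarrow> test_fun (\<lambda>x. f (x - a))"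
  using test_fun_affine[of f 1 a] by simp

section \<open>The cubic B-spline as a convolution of hat functions\<close>

lemma tent_convolution_nonneg:
  assumes c: "0 \<le> c"
  shows "(LINT t|lborel. tent t * tent (t - c)) = cubic_spline c"
proof -
  let ?f = "\<lambda>t. tent t * tent (t - c)"
  have b: "test_fun ?f" by (intro test_fun_mult test_fun_shift test_fun_tent)
  consider "c \<le> 1" | "1 < c" "c \<le> 2" | "2 < c" by linarith
  then show ?thesis
  proof cases
    case 1
    \<comment> \<open>On its support the integrand is quadratic between the consecutive kinks c - 1,
      0, c, 1; these are antiderivatives on the three pieces.\<close>
    define P Q R where "P = (\<lambda>t::real. (1 - c) * t + (1 - c / 2) * t\<^sup>2 + t ^ 3 / 3)"
      and "Q = (\<lambda>t::real. (1 - c) * t + c * t\<^sup>2 / 2 - t ^ 3 / 3)"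
      and "R = (\<lambda>t::real. (1 + c) * t - (2 + c) * t\<^sup>2 / 2 + t ^ 3 / 3)"
    have p: "(?f has_integral P 0 - P (c - 1)) {c - 1..0}"
      by (rule has_integral_FTC[where F' = "\<lambda>t. (1 + t) * (1 - c + t)" and F = P])
        (use c 1 in \<open>auto simp: P_def tent_def max_def algebra_simps power2_eq_square intro!: derivative_eq_intros\<close>)
    have q: "(?f has_integral Q c - Q 0) {0..c}"
      by (rule has_integral_FTC[where F' = "\<lambda>t. (1 - t) * (1 - c + t)" and F = Q])
        (use c 1 in \<open>auto simp: Q_def tent_def max_def algebra_simps power2_eq_square intro!: derivative_eq_intros\<close>)
    have r: "(?f has_integral R 1 - R c) {c..1}"
      by (rule has_integral_FTC[where F' = "\<lambda>t. (1 - t) * (1 + c - t)" and F = R])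
        (use c \<open>c \<le> 1\<close> in \<open>auto simp: R_def tent_def max_def algebra_simps power2_eq_square intro!: derivative_eq_intros\<close>)
    have "(?f has_integral (P 0 - P (c - 1)) + (Q c - Q 0) + (R 1 - R c)) {c - 1..1}"
      using c \<open>c \<le> 1\<close>
      by (intro has_integral_combine[OF _ _ has_integral_combine[OF _ _ p q] r]) auto
    moreover have "(P 0 - P (c - 1)) + (Q c - Q 0) + (R 1 - R c) = cubic_spline c"
      using c \<open>c \<le> 1\<close>
      by (simp add: cubic_spline_inner P_def Q_def R_def power2_eq_square power3_eq_cube field_simps)
    moreover have "?f x = 0" if "x \<notin> {c - 1..1}" for x
      using that by (auto simp: tent_def)
    ultimately show ?thesis using test_fun_integral_eq[OF b] by metis
  next
    case 2
    \<comment> \<open>The supports now meet only in [c - 1, 1], which lies between the two centres,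
      so a single polynomial covers the overlap.\<close>
    define S where "S = (\<lambda>t::real. (1 - c) * t + c * t\<^sup>2 / 2 - t ^ 3 / 3)"
    have "(?f has_integral S 1 - S (c - 1)) {c - 1..1}"
      by (rule has_integral_FTC[where F' = "\<lambda>t. (1 - t) * (1 - c + t)" and F = S])
        (use 2 in \<open>auto simp: S_def tent_def algebra_simps power2_eq_square intro!: derivative_eq_intros\<close>)
    moreover have "S 1 - S (c - 1) = cubic_spline c"
      using 2 by (simp add: cubic_spline_outer S_def power2_eq_square power3_eq_cube field_simps)
    moreover have "?f x = 0" if "x \<notin> {c - 1..1}" for x
      using that by (auto simp: tent_def)
    ultimately show ?thesis using test_fun_integral_eq[OF b] by metis
  next
    case 3
    then have "?f = (\<lambda>t. 0)" by (auto simp: tent_def fun_eq_iff)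
    then show ?thesis using 3 c by (simp add: cubic_spline_zero)
  qed
qed

lemma tent_convolution:
  "(LINT t|lborel. tent (t - a) * tent (t - b)) = cubic_spline (a - b)"
proof -
  have s: "(LINT t|lborel. tent (t - a) * tent (t - b)) = (LINT t|lborel. tent t * tent (t - (b - a)))" for a b
    by (subst lborel_integral_real_affine[where c = 1 and t = a]) (auto simp: algebra_simps)
  show ?thesis
  proof (cases "a \<le> b")
    case True
    then show ?thesis using tent_convolution_nonneg[of "b - a"] cubic_spline_minus[of "b - a"]
      by (simp add: s)
  next
    case False
    have "(LINT t|lborel. tent (t - a) * tent (t - b)) = (LINT t|lborel. tent (t - b) * tent (t - a))"
      by (simp add: mult.commute)
    then show ?thesis using tent_convolution_nonneg[of "a - b"] False by (simp add: s)
  qed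
qed

section \<open>Duality and orthogonality on the unit cell\<close>

lemma LINT_shift: "(LINT t|lborel. f (t - a) * g (t - b)) = (LINT t|lborel. (f (t - (a - b)) * g t :: real))" for a b :: real
  by (subst lborel_integral_real_affine[where c = 1 and t = b]) (auto simp: algebra_simps)

lemma LINT_unit_interval:
  fixes f :: "real \<Rightarrow> real"
  assumes b: "test_fun f" and z: "\<And>x. x < 0 \<or> 1 \<le> x \<Longrightarrow> f x = 0"
    and F: "\<And>x. (F has_real_derivative F' x) (at x)"
    and f: "\<And>x. 0 \<le> x \<Longrightarrow> x < 1 \<Longrightarrow> f x = F' x" and I: "F 1 - F 0 = I"
  shows "(LINT t|lborel. f t) = I"
proof (rule test_fun_integral_eq[OF b])
  have "(F' has_integral I) {0..1}" by (rule has_integral_FTC[OF _ F _ I]) auto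
  \<comment> \<open>The dual functions are cut off at the right end of the half-open cell, so the
    integrand and the polynomial may differ at 1.\<close>
  then show "(f has_integral I) {0..1}"
    by (rule has_integral_spike_finite[of "{1}", rotated 2]) (use f in auto)
qed (use z in auto)

text \<open>On the cell only the hats centred at 0 and 1 are nonzero, namely 1 - t and t. The
  polynomial 4 - 6 t is the linear one with inner products 1 and 0 against them.\<close>

lemma tent_dual_duality:
  "(LINT t|lborel. tent (t - of_int j) * tent_dual (t - of_int k)) = (if j = k then 1 else 0)"
proof -
  let ?m = "j - k"
  let ?f = "\<lambda>t. tent (t - of_int ?m) * tent_dual t"
  have b: "test_fun ?f" by (intro test_fun_mult test_fun_shift test_fun_tent test_fun_tent_dual)
  have z: "?f x = 0" if "x < 0 \<or> 1 \<le> x" for x using that by (auto simp: tent_dual_def)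
  have "(LINT t|lborel. ?f t) = (if j = k then 1 else 0)"
  proof -
    consider "?m = 0" | "?m = 1" | "?m \<le> -1 \<or> 2 \<le> ?m" by linarith
    then show ?thesis
    proof cases
      case 1
      show ?thesis using 1
        by (intro LINT_unit_interval[OF b z, where F' = "\<lambda>t. 4 - 10 * t + 6 * t\<^sup>2" and F = "\<lambda>t. 4 * t - 5 * t\<^sup>2 + 2 * t ^ 3"])
          (auto simp: tent_def tent_dual_def algebra_simps power2_eq_square intro!: derivative_eq_intros)
    next
      case 2
      show ?thesis unfolding 2 using 2
        by (intro LINT_unit_interval[OF b[unfolded 2] z[unfolded 2], where F' = "\<lambda>t. 4 * t - 6 * t\<^sup>2" and F = "\<lambda>t. 2 * t\<^sup>2 - 2 * t ^ 3"])
          (auto simp: tent_def tent_dual_def algebra_simps power2_eq_square intro!: derivative_eq_intros)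
    next
      case 3
      then have "real_of_int ?m \<le> -1 \<or> 2 \<le> real_of_int ?m" by linarith
      then have "?f = (\<lambda>t. 0)" by (auto simp: tent_def tent_dual_def fun_eq_iff)
      then show ?thesis using 3 by auto
    qed
  qed
  then show ?thesis by (subst LINT_shift) simp
qed

text \<open>Dual functions of different cells have disjoint supports. The squared norm 4 is the
  price per coordinate of reading off a coefficient and becomes 4 ^ CARD('n) in
  \<open>autocorr_zero_lower\<close>.\<close>

lemma tent_dual_orthogonal:
  "(LINT t|lborel. tent_dual (t - of_int j) * tent_dual (t - of_int k)) = (if j = k then 4 else 0)"
proof -
  let ?m = "j - k"
  let ?f = "\<lambda>t. tent_dual (t - of_int ?m) * tent_dual t"
  have b: "test_fun ?f" by (intro test_fun_mult test_fun_shift test_fun_tent_dual)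
  have z: "?f x = 0" if "x < 0 \<or> 1 \<le> x" for x using that by (auto simp: tent_dual_def)
  have "(LINT t|lborel. ?f t) = (if j = k then 4 else 0)"
  proof (cases "j = k")
    case True
    then show ?thesis
      by (intro LINT_unit_interval[OF b z, where F' = "\<lambda>t. 16 - 48 * t + 36 * t\<^sup>2" and F = "\<lambda>t. 16 * t - 24 * t\<^sup>2 + 12 * t ^ 3"])
        (auto simp: tent_dual_def algebra_simps power2_eq_square intro!: derivative_eq_intros)
  next
    case False
    then have "real_of_int ?m \<le> -1 \<or> 1 \<le> real_of_int ?m" by linarith
    then have "?f = (\<lambda>t. 0)" by (auto simp: tent_dual_def fun_eq_iff)
    then show ?thesis using False by auto
  qed
  then show ?thesis by (subst LINT_shift) simp
qed

text \<open>The number 576 is the integral of the squared dual cubic, the counterpart of 4 for hats;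
  it reappears as a power in \<open>lattice_fun_lower\<close>.\<close>

lemma spline_dual_orthogonal:
  "(LINT t|lborel. spline_dual (t - of_int j) * spline_dual (t - of_int k)) = (if j = k then 576 else 0)"
proof -
  let ?m = "j - k"
  let ?f = "\<lambda>t. spline_dual (t - of_int ?m) * spline_dual t"
  have b: "test_fun ?f" by (intro test_fun_mult test_fun_shift test_fun_spline_dual)
  have z: "?f x = 0" if "x < 0 \<or> 1 \<le> x" for x using that by (auto simp: spline_dual_def)
  have "(LINT t|lborel. ?f t) = (if j = k then 576 else 0)"
  proof (cases "j = k")
    case True
    show ?thesis
    proof (rule LINT_unit_interval[OF b z])
      show "((\<lambda>t. 4096 * t - 49920 * t ^ 2 + 284720 * t ^ 3 - 789120 * t ^ 4 + 1130400 * t ^ 5 - 806400 * t ^ 6 + 226800 * t ^ 7) has_real_derivative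
          4096 - 99840 * x + 854160 * x ^ 2 - 3156480 * x ^ 3 + 5652000 * x ^ 4 - 4838400 * x ^ 5 + 1587600 * x ^ 6) (at x)" for x
        by (rule derivative_eq_intros refl | simp)+
      show "?f x = 4096 - 99840 * x + 854160 * x ^ 2 - 3156480 * x ^ 3 + 5652000 * x ^ 4 - 4838400 * x ^ 5 + 1587600 * x ^ 6"
        if "0 \<le> x" "x < 1" for x
      proof -
        have "?f x = (1260 * x ^ 3 - 1920 * x\<^sup>2 + 780 * x - 64)\<^sup>2"
          using that True by (simp add: spline_dual_def power2_eq_square)
        then show ?thesis by algebra
      qed
    qed (use True in simp_all)
  next
    case False
    then have "real_of_int ?m \<le> -1 \<or> 1 \<le> real_of_int ?m" by linarith
    then have "?f = (\<lambda>t. 0)" by (auto simp: spline_dual_def fun_eq_iff)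
    then show ?thesis using False by auto
  qed
  then show ?thesis by (subst LINT_shift) simp
qed

text \<open>Only the four translates centred at -1, 0, 1, 2 reach the cell. Their restrictions form
  a basis of the cubic polynomials there, which determines the dual cubic uniquely. Each case
  integrates the expanded product of two cubics.\<close>

lemma spline_dual_duality:
  "(LINT t|lborel. cubic_spline (t - of_int j) * spline_dual (t - of_int k)) = (if j = k then 1 else 0)"
proof -
  let ?m = "j - k"
  let ?f = "\<lambda>t. cubic_spline (t - of_int ?m) * spline_dual t"
  have b: "test_fun ?f" by (intro test_fun_mult test_fun_shift test_fun_spline_dual test_fun_cubic_spline)
  have z: "?f x = 0" if "x < 0 \<or> 1 \<le> x" for x using that by (auto simp: spline_dual_def)
  consider "?m = -1" | "?m = 0" | "?m = 1" | "?m = 2" | "?m \<le> -2 \<or> 3 \<le> ?m" by linarith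
  then have "(LINT t|lborel. ?f t) = (if j = k then 1 else 0)"
  proof cases
    case 1
    show ?thesis
    proof (rule LINT_unit_interval[OF b z])
      show "((\<lambda>t. - 32 * t / 3 + 81 * t ^ 2 - 742 * t ^ 3 / 3 + 1178 * t ^ 4 / 3 - 344 * t ^ 5 + 475 * t ^ 6 / 3 - 30 * t ^ 7) has_real_derivative
          - 32 / 3 + 162 * x - 742 * x ^ 2 + 4712 * x ^ 3 / 3 - 1720 * x ^ 4 + 950 * x ^ 5 - 210 * x ^ 6) (at x)" for x
        by (rule derivative_eq_intros refl | simp)+
      show "?f x = - 32 / 3 + 162 * x - 742 * x ^ 2 + 4712 * x ^ 3 / 3 - 1720 * x ^ 4 + 950 * x ^ 5 - 210 * x ^ 6" if "0 \<le> x" "x < 1" for x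
      proof -
        have "cubic_spline (x - of_int ?m) = (1 - x) ^ 3 / 6"
          unfolding 1 using cubic_spline_outer[of "x + 1"] that by simp
        then have "?f x = ((1 - x) ^ 3 / 6) * (1260 * x ^ 3 - 1920 * x\<^sup>2 + 780 * x - 64)"
          using that by (simp add: spline_dual_def)
        then show ?thesis by (simp add: field_simps power2_eq_square power3_eq_cube eval_nat_numeral)
      qed
    qed (use 1 in simp_all)
  next
    case 2
    show ?thesis
    proof (rule LINT_unit_interval[OF b z])
      show "((\<lambda>t. - 128 * t / 3 + 260 * t ^ 2 - 1216 * t ^ 3 / 3 + 7 * t ^ 4 + 462 * t ^ 5 - 370 * t ^ 6 + 90 * t ^ 7) has_real_derivative
          - 128 / 3 + 520 * x - 1216 * x ^ 2 + 28 * x ^ 3 + 2310 * x ^ 4 - 2220 * x ^ 5 + 630 * x ^ 6) (at x)" for x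
        by (rule derivative_eq_intros refl | simp)+
      show "?f x = - 128 / 3 + 520 * x - 1216 * x ^ 2 + 28 * x ^ 3 + 2310 * x ^ 4 - 2220 * x ^ 5 + 630 * x ^ 6" if "0 \<le> x" "x < 1" for x
      proof -
        have "cubic_spline (x - of_int ?m) = 2/3 - x\<^sup>2 + x ^ 3 / 2"
          unfolding 2 using cubic_spline_inner[of x] that by simp
        then have "?f x = (2/3 - x\<^sup>2 + x ^ 3 / 2) * (1260 * x ^ 3 - 1920 * x\<^sup>2 + 780 * x - 64)"
          using that by (simp add: spline_dual_def)
        then show ?thesis by (simp add: field_simps power2_eq_square power3_eq_cube eval_nat_numeral)
      qed
    qed (use 2 in simp_all)
  next
    case 3
    show ?thesis
    proof (rule LINT_unit_interval[OF b z])
      show "((\<lambda>t. - 32 * t / 3 + 49 * t ^ 2 + 38 * t ^ 3 / 3 - 82 * t ^ 4 - 144 * t ^ 5 + 265 * t ^ 6 - 90 * t ^ 7) has_real_derivative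
          - 32 / 3 + 98 * x + 38 * x ^ 2 - 328 * x ^ 3 - 720 * x ^ 4 + 1590 * x ^ 5 - 630 * x ^ 6) (at x)" for x
        by (rule derivative_eq_intros refl | simp)+
      show "?f x = - 32 / 3 + 98 * x + 38 * x ^ 2 - 328 * x ^ 3 - 720 * x ^ 4 + 1590 * x ^ 5 - 630 * x ^ 6" if "0 \<le> x" "x < 1" for x
      proof -
        have "cubic_spline (x - of_int ?m) = 2/3 - (1 - x)\<^sup>2 + (1 - x) ^ 3 / 2"
          unfolding 3 using cubic_spline_inner[of "x - 1"] that by (simp add: power2_commute)
        then have "?f x = (2/3 - (1 - x)\<^sup>2 + (1 - x) ^ 3 / 2) * (1260 * x ^ 3 - 1920 * x\<^sup>2 + 780 * x - 64)"
          using that by (simp add: spline_dual_def)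
        then show ?thesis by (simp add: field_simps power2_eq_square power3_eq_cube eval_nat_numeral)
      qed
    qed (use 3 in simp_all)
  next
    case 4
    show ?thesis
    proof (rule LINT_unit_interval[OF b z])
      show "((\<lambda>t. - 8 * t ^ 4 / 3 + 26 * t ^ 5 - 160 * t ^ 6 / 3 + 30 * t ^ 7) has_real_derivative
          - 32 * x ^ 3 / 3 + 130 * x ^ 4 - 320 * x ^ 5 + 210 * x ^ 6) (at x)" for x
        by (rule derivative_eq_intros refl | simp)+
      show "?f x = - 32 * x ^ 3 / 3 + 130 * x ^ 4 - 320 * x ^ 5 + 210 * x ^ 6" if "0 \<le> x" "x < 1" for x
      proof -
        have "cubic_spline (x - of_int ?m) = x ^ 3 / 6"
          unfolding 4 using cubic_spline_outer[of "x - 2"] that by simp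
        then have "?f x = (x ^ 3 / 6) * (1260 * x ^ 3 - 1920 * x\<^sup>2 + 780 * x - 64)"
          using that by (simp add: spline_dual_def)
        then show ?thesis by (simp add: field_simps power2_eq_square power3_eq_cube eval_nat_numeral)
      qed
    qed (use 4 in simp_all)
  next
    case 5
    then have "real_of_int ?m \<le> -2 \<or> 3 \<le> real_of_int ?m" by linarith
    then have "?f = (\<lambda>t. 0)" by (auto simp: spline_dual_def cubic_spline_zero fun_eq_iff)
    then show ?thesis using 5 by auto
  qed
  then show ?thesis by (subst LINT_shift) simp
qed

section \<open>Tensor products\<close>

definition tensor :: "real^'n \<Rightarrow> (real \<Rightarrow> real) \<Rightarrow> real^'n \<Rightarrow> real" where
  "tensor h f y = (\<Prod>j\<in>UNIV. f (y $ j / h $ j))"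

definition cell :: "real^'n \<Rightarrow> real" where
  "cell h = (\<Prod>j\<in>UNIV. h $ j)"

text \<open>Lebesgue measure on vectors is the image of a product measure indexed by
  \<open>Basis\<close>, so Fubini for finite products applies once coordinates are matched with axis
  vectors.\<close>

lemma product_integral_vec:
  fixes f :: "'n::finite \<Rightarrow> real \<Rightarrow> real"
  assumes f: "\<And>j. integrable lborel (f j)"
  shows "integrable lborel (\<lambda>x::real^'n. \<Prod>j\<in>UNIV. f j (x $ j))" (is ?i)
    and "(LINT (x::real^'n)|lborel. (\<Prod>j\<in>UNIV. f j (x $ j))) = (\<Prod>j\<in>UNIV. LINT t|lborel. f j t)" (is ?e)
proof -
  interpret product_sigma_finite "\<lambda>_::real^'n. lborel::real measure"
    by standard
  let ?a = "\<lambda>j::'n. axis j (1::real)"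
  \<comment> \<open>Factors are relabelled by basis vectors; \<open>inv ?a\<close> recovers the
    coordinate index.\<close>
  define g where "g b = f (inv ?a b)" for b :: "real^'n"
  have inj: "inj ?a" by (auto intro!: injI simp: axis_eq_axis)
  have B: "(Basis :: (real^'n) set) = range ?a" by (auto simp: Basis_vec_def)
  have g: "g (?a j) = f j" for j unfolding g_def inv_f_f[OF inj] ..
  have [measurable]: "f j \<in> borel_measurable borel" for j using f[of j] by simp
  have meas [measurable]: "(\<lambda>x::real^'n. \<Prod>j\<in>UNIV. f j (x $ j)) \<in> borel_measurable borel" by measurable
  have ig: "integrable lborel (g b)" if "b \<in> Basis" for b using that f by (auto simp: B g)
  have P: "(\<Prod>j\<in>UNIV. f j ((\<Sum>b\<in>Basis. y b *\<^sub>R b) $ j)) = (\<Prod>b\<in>Basis. g b (y b))" for y :: "real^'n \<Rightarrow> real"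
  proof -
    have "(\<Sum>b\<in>Basis. y b *\<^sub>R b) $ j = y (?a j)" for j
      by (simp add: cart_eq_inner_axis inner_sum_left_Basis axis_in_Basis_iff)
    then show ?thesis by (simp add: B prod.reindex[OF inj] g)
  qed
  have D: "(lborel :: (real^'n) measure) = distr (\<Pi>\<^sub>M b\<in>Basis. lborel) borel (\<lambda>f. \<Sum>b\<in>Basis. f b *\<^sub>R b)"
    by (rule lborel_eq)
  have m: "(\<lambda>f. \<Sum>b\<in>Basis. f b *\<^sub>R b) \<in> (\<Pi>\<^sub>M b\<in>Basis. lborel) \<rightarrow>\<^sub>M (borel :: (real^'n) measure)"
    by measurable
  show ?i
    by (subst D, subst integrable_distr_eq[OF m meas], unfold P, rule product_integrable_prod)
      (simp_all add: ig)
  have "(LINT (x::real^'n)|lborel. (\<Prod>j\<in>UNIV. f j (x $ j))) = (LINT y|(\<Pi>\<^sub>M b\<in>Basis. lborel). (\<Prod>b\<in>Basis. g b (y b)))"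
    by (subst D, subst integral_distr[OF m meas], unfold P, rule refl)
  also have "\<dots> = (\<Prod>b\<in>Basis. LINT t|lborel. g b t)"
    by (rule product_integral_prod) (auto simp: ig)
  also have "\<dots> = (\<Prod>j\<in>UNIV. LINT t|lborel. f j t)"
    by (simp add: B prod.reindex[OF inj] g)
  finally show ?e .
qed

lemma test_fun_tensor:
  fixes h :: "real^'n"
  assumes f: "test_fun f" and h: "\<And>j. 0 < h $ j"
  shows "test_fun (tensor h f)"
proof -
  obtain M R where fm [measurable]: "f \<in> borel_measurable borel" and M: "\<And>x. \<bar>f x\<bar> \<le> M" and R: "\<And>x. R < norm x \<Longrightarrow> f x = 0"
    using f unfolding test_fun_def by blast
  have "\<bar>tensor h f y\<bar> \<le> M ^ CARD('n)" for y
  proof -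
    have "(\<Prod>j\<in>UNIV. \<bar>f (y $ j / h $ j)\<bar>) \<le> (\<Prod>j\<in>(UNIV::'n set). M)"
      by (rule prod_mono) (simp add: M)
    then show ?thesis by (simp add: tensor_def abs_prod)
  qed
  moreover have "tensor h f y = 0" if y: "(\<Sum>j\<in>UNIV. R * h $ j) < norm y" for y
  proof -
    have "\<exists>j. R * h $ j < \<bar>y $ j\<bar>"
    proof (rule ccontr)
      assume "\<not> ?thesis"
      then have "(\<Sum>j\<in>UNIV. \<bar>y $ j\<bar>) \<le> (\<Sum>j\<in>UNIV. R * h $ j)" by (intro sum_mono) (auto simp: not_less)
      then show False using norm_le_l1_cart[of y] y by simp
    qed
    then obtain j where "R * h $ j < \<bar>y $ j\<bar>" ..
    then have "R < norm (y $ j / h $ j)" using h[of j] by (simp add: field_simps)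
    then have "f (y $ j / h $ j) = 0" by (rule R)
    then show ?thesis unfolding tensor_def by (intro prod_zero) (simp, blast)
  qed
  moreover have "tensor h f \<in> borel_measurable borel" unfolding tensor_def[abs_def] by measurable
  ultimately show ?thesis unfolding test_fun_def by blast
qed

lemma tensor_inner:
  fixes h :: "real^'n"
  assumes f: "test_fun f" and g: "test_fun g" and h: "\<And>j. 0 < h $ j"
  shows "(LINT x|lborel. tensor h f (x - a) * tensor h g (x - b)) =
    cell h * (\<Prod>j\<in>UNIV. LINT t|lborel. f (t - a $ j / h $ j) * g (t - b $ j / h $ j))"
proof -
  let ?F = "\<lambda>j t. f (t / h $ j - a $ j / h $ j) * g (t / h $ j - b $ j / h $ j)"
  have 1: "integrable lborel (?F j)" for j
  proof -
    have sc: "test_fun (\<lambda>t. f (t / h $ j - c))" if "test_fun f" for f :: "real \<Rightarrow> real" and c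
      using test_fun_affine[OF that, of "1 / h $ j" c] h[of j] by simp
    then show ?thesis by (intro test_fun_integrable test_fun_mult sc f g)
  qed
  have 2: "(LINT t|lborel. ?F j t) = h $ j * (LINT t|lborel. f (t - a $ j / h $ j) * g (t - b $ j / h $ j))" for j
    using h[of j] by (subst lborel_integral_real_affine[where c = "h $ j" and t = 0]) (auto simp: mult.commute)
  have "(LINT x|lborel. tensor h f (x - a) * tensor h g (x - b)) = (LINT x|lborel. (\<Prod>j\<in>UNIV. ?F j (x $ j)))"
    by (simp add: tensor_def prod.distrib diff_divide_distrib)
  also have "\<dots> = (\<Prod>j\<in>UNIV. LINT t|lborel. ?F j t)"
    by (rule product_integral_vec) (rule 1)
  also have "\<dots> = cell h * (\<Prod>j\<in>UNIV. LINT t|lborel. f (t - a $ j / h $ j) * g (t - b $ j / h $ j))"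
    by (simp add: 2 cell_def prod.distrib)
  finally show ?thesis .
qed

lemma tensor_tent_convolution:
  fixes h :: "real^'n"
  assumes h: "\<And>j. 0 < h $ j"
  shows "(LINT x|lborel. tensor h tent (x - a) * tensor h tent (x - b)) = cell h * tensor h cubic_spline (a - b)"
  unfolding tensor_inner[OF test_fun_tent test_fun_tent h]
  by (simp add: tent_convolution tensor_def diff_divide_distrib)

text \<open>Distinct indices differ in some coordinate, and its vanishing factor kills the product.
  Applied with c = 1 for functions against their duals, and with c = 4 or 576 for the duals among
  themselves.\<close>

lemma tensor_lattice_inner:
  fixes h :: "real^'n" and j k :: "int^'n"
  assumes f: "test_fun f" and g: "test_fun g" and h: "\<And>j. 0 < h $ j"
    and fg: "\<And>j k::int. (LINT t|lborel. f (t - of_int j) * g (t - of_int k)) = (if j = k then c else 0)"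
  shows "(LINT x|lborel. tensor h f (x - grid_point h j) * tensor h g (x - grid_point h k)) =
    (if j = k then cell h * c ^ CARD('n) else 0)"
proof -
  have [simp]: "h $ i \<noteq> 0" for i using h[of i] by simp
  have "(LINT x|lborel. tensor h f (x - grid_point h j) * tensor h g (x - grid_point h k)) =
     cell h * (\<Prod>i\<in>UNIV. if j $ i = k $ i then c else 0)"
    unfolding tensor_inner[OF f g h] by (simp add: grid_point_def fg)
  also have "\<dots> = (if j = k then cell h * c ^ CARD('n) else 0)"
  proof (cases "j = k")
    case False
    then obtain i where "j $ i \<noteq> k $ i" by (auto simp: vec_eq_iff)
    then have "(\<Prod>i\<in>UNIV. if j $ i = k $ i then c else 0) = 0" by (intro prod_zero) (simp, metis UNIV_I)
    then show ?thesis using False by simp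
  qed simp
  finally show ?thesis .
qed

text \<open>With B and G the combinations of the \<open>b k\<close> and of the dual
  \<open>g k\<close> with the same coefficients, and S the coefficient sum, the pairing of B with G
  is v S and the squared norm of G is v c S. Expanding the nonnegative squared norm of c B - G and
  dividing by c gives the bound.\<close>

lemma riesz_lower_bound:
  fixes b g :: "'k \<Rightarrow> 'a::euclidean_space \<Rightarrow> real" and F :: "'k \<Rightarrow> 'b::euclidean_space"
  assumes K: "finite K" and c: "0 < c"
    and test_fun: "\<And>k. k \<in> K \<Longrightarrow> test_fun (b k)" "\<And>k. k \<in> K \<Longrightarrow> test_fun (g k)"
    and bg: "\<And>j k. j \<in> K \<Longrightarrow> k \<in> K \<Longrightarrow> (LINT x|lborel. b j x * g k x) = (if j = k then v else 0)"
    and gg: "\<And>j k. j \<in> K \<Longrightarrow> k \<in> K \<Longrightarrow> (LINT x|lborel. g j x * g k x) = (if j = k then v * c else 0)"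
  shows "v * (\<Sum>k\<in>K. (norm (F k))\<^sup>2) \<le> c * (LINT x|lborel. (norm (\<Sum>k\<in>K. b k x *\<^sub>R F k))\<^sup>2)"
proof -
  let ?B = "\<lambda>x. \<Sum>k\<in>K. b k x *\<^sub>R F k" and ?G = "\<lambda>x. \<Sum>k\<in>K. g k x *\<^sub>R F k"
  have expand: "(LINT x|lborel. (\<Sum>j\<in>K. p j x *\<^sub>R F j) \<bullet> (\<Sum>k\<in>K. q k x *\<^sub>R F k)) =
      (\<Sum>j\<in>K. \<Sum>k\<in>K. (LINT x|lborel. p j x * q k x) * (F j \<bullet> F k))" (is ?e)
    and int: "integrable lborel (\<lambda>x. (\<Sum>j\<in>K. p j x *\<^sub>R F j) \<bullet> (\<Sum>k\<in>K. q k x *\<^sub>R F k))" (is ?i)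
    if "\<And>k. k \<in> K \<Longrightarrow> test_fun (p k)" "\<And>k. k \<in> K \<Longrightarrow> test_fun (q k)" for p q :: "'k \<Rightarrow> 'a \<Rightarrow> real"
  proof -
    have e: "(\<lambda>x. (\<Sum>j\<in>K. p j x *\<^sub>R F j) \<bullet> (\<Sum>k\<in>K. q k x *\<^sub>R F k)) =
        (\<lambda>x. \<Sum>j\<in>K. \<Sum>k\<in>K. (p j x * q k x) * (F j \<bullet> F k))"
      unfolding inner_sum_left inner_sum_right by (simp add: mult_ac) (intro ext sum.swap)
    have i: "integrable lborel (\<lambda>x. p j x * q k x)" if "j \<in> K" "k \<in> K" for j k
      using that by (intro test_fun_integrable test_fun_mult \<open>\<And>k. k \<in> K \<Longrightarrow> test_fun (p k)\<close> \<open>\<And>k. k \<in> K \<Longrightarrow> test_fun (q k)\<close>)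
    show ?i unfolding e by (intro Bochner_Integration.integrable_sum integrable_mult_left i)
    show ?e unfolding e by (simp add: i)
  qed
  note iBB = int[OF test_fun(1) test_fun(1)] and iBG = int[OF test_fun(1) test_fun(2)] and iGG = int[OF test_fun(2) test_fun(2)]
  let ?S = "\<Sum>k\<in>K. (norm (F k))\<^sup>2"
  have BG: "(LINT x|lborel. ?B x \<bullet> ?G x) = v * ?S"
    using K by (subst expand[OF test_fun]) (simp_all add: bg sum.delta if_distrib[of "\<lambda>x. x * _"] power2_norm_eq_inner sum_distrib_left cong: if_cong)
  have GG: "(LINT x|lborel. ?G x \<bullet> ?G x) = v * c * ?S"
    using K by (subst expand[OF test_fun(2) test_fun(2)]) (simp_all add: gg sum.delta if_distrib[of "\<lambda>x. x * _"] power2_norm_eq_inner sum_distrib_left cong: if_cong)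
  have "0 \<le> (LINT x|lborel. (c *\<^sub>R ?B x - ?G x) \<bullet> (c *\<^sub>R ?B x - ?G x))"
    by simp
  also have "\<dots> = (LINT x|lborel. c\<^sup>2 * (?B x \<bullet> ?B x) - 2 * c * (?B x \<bullet> ?G x) + ?G x \<bullet> ?G x)"
    by (intro Bochner_Integration.integral_cong refl)
      (simp only: inner_diff_left inner_diff_right inner_scaleR_left inner_scaleR_right inner_commute[of "?G _" "?B _"],
        simp add: power2_eq_square algebra_simps)
  also have "\<dots> = c\<^sup>2 * (LINT x|lborel. ?B x \<bullet> ?B x) - 2 * c * (v * ?S) + v * c * ?S"
    using iBB iBG iGG by (simp add: BG GG)
  also have "\<dots> = c * (c * (LINT x|lborel. ?B x \<bullet> ?B x) - v * ?S)"
    by (simp add: power2_eq_square algebra_simps)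
  finally have "v * ?S \<le> c * (LINT x|lborel. ?B x \<bullet> ?B x)"
    using c by (simp add: zero_le_mult_iff)
  then show ?thesis by (simp add: power2_norm_eq_inner)
qed

section \<open>Correlations of hat interpolants\<close>

lemma test_fun_sum:
  assumes "\<And>k. k \<in> K \<Longrightarrow> test_fun (f k)"
  shows "test_fun (\<lambda>x. \<Sum>k\<in>K. c k * f k x)"
  using assms
proof (induction K rule: infinite_finite_induct)
  case (insert k K)
  have add: "test_fun (\<lambda>x. f x + g x)" if fg: "test_fun f" "test_fun g" for f g :: "'b \<Rightarrow> real"
  proof -
    obtain M R N S where m: "f \<in> borel_measurable borel" "g \<in> borel_measurable borel"
      and M: "\<And>x. \<bar>f x\<bar> \<le> M" "\<And>x. \<bar>g x\<bar> \<le> N" and R: "\<And>x. R < norm x \<Longrightarrow> f x = 0" "\<And>x. S < norm x \<Longrightarrow> g x = 0"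
      using fg unfolding test_fun_def by (elim conjE exE) blast
    have "\<bar>f x + g x\<bar> \<le> M + N" for x using M[of x] by linarith
    moreover have "f x + g x = 0" if "max R S < norm x" for x using R[of x] that by simp
    ultimately show ?thesis using m unfolding test_fun_def by (metis borel_measurable_add)
  qed
  have "test_fun (\<lambda>x. c k * f k x)"
  proof -
    have "test_fun (f k)" using insert by simp
    then obtain M R where m: "f k \<in> borel_measurable borel"
      and M: "\<And>x. \<bar>f k x\<bar> \<le> M" and R: "\<And>x. R < norm x \<Longrightarrow> f k x = 0"
      unfolding test_fun_def by blast
    have "\<bar>c k * f k x\<bar> \<le> \<bar>c k\<bar> * M" for x using M[of x] by (simp add: abs_mult mult_left_mono)
    moreover have "c k * f k x = 0" if "R < norm x" for x using R[OF that] by simp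
    moreover have "(\<lambda>x. c k * f k x) \<in> borel_measurable borel" using m by measurable
    ultimately show ?thesis unfolding test_fun_def by blast
  qed
  from add[OF this insert.IH] insert show ?case by simp
qed (auto simp: test_fun_def)

section \<open>Smoothness of the splines by way of hat functions\<close>

locale grid =
  fixes h :: "real^'n"
  assumes h_pos: "\<And>j. 0 < h $ j"
begin

abbreviation psi :: "real^'n \<Rightarrow> real" where "psi \<equiv> tensor h cubic_spline"
abbreviation hat :: "real^'n \<Rightarrow> real" where "hat \<equiv> tensor h tent"

lemma h_nonzero [simp]: "h $ j \<noteq> 0"
  using h_pos[of j] by simp

lemma cell_pos: "0 < cell h"
  unfolding cell_def by (intro prod_pos) (simp add: h_pos)

lemma rk_basis_eq: "rk_basis h k x = psi (x - grid_point h k)"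
  unfolding rk_basis_def tensor_def cubic_spline_def grid_point_def
  using h_pos by (intro prod.cong refl) (simp add: abs_divide less_imp_le field_simps)

lemma psi_minus: "psi (- y) = psi y"
  by (simp add: tensor_def cubic_spline_minus)

lemma psi_zero:
  assumes "2 * (\<Sum>j\<in>UNIV. h $ j) \<le> norm y" shows "psi y = 0"
proof -
  have "\<exists>j. 2 * h $ j \<le> \<bar>y $ j\<bar>"
  proof (rule ccontr)
    assume "\<not> ?thesis"
    then have "(\<Sum>j\<in>UNIV. \<bar>y $ j\<bar>) < (\<Sum>j\<in>UNIV. 2 * h $ j)" by (intro sum_strict_mono) (auto simp: not_le)
    then show False using norm_le_l1_cart[of y] assms by (simp add: sum_distrib_left)
  qed
  then obtain j where "2 * h $ j \<le> \<bar>y $ j\<bar>" ..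
  then have "2 \<le> \<bar>y $ j / h $ j\<bar>" using h_pos[of j] by (simp add: field_simps abs_divide)
  then have "cubic_spline (y $ j / h $ j) = 0" by (rule cubic_spline_zero)
  then show ?thesis unfolding tensor_def by (intro prod_zero) (simp, blast)
qed

text \<open>Blows up as the mesh is refined. It is used only to dominate integrands and never
  reaches the constants of the coercivity estimates.\<close>

definition curv :: real where "curv = (\<Sum>j\<in>UNIV. 1 / (h $ j)\<^sup>2)"

text \<open>All factors lie in [0, 1], so the difference of the two products is at most the sum of
  the coordinatewise drops, each quadratic by \<open>cubic_spline_drop\<close>.\<close>

lemma psi_drop: "psi 0 - psi y \<le> curv * (norm y)\<^sup>2"
proof -
  have le1: "norm (cubic_spline t) \<le> 1" for t
    using cubic_spline_range[of t] by simp
  have "psi 0 - psi y \<le> norm ((\<Prod>j\<in>UNIV. cubic_spline ((0::real^'n) $ j / h $ j)) - (\<Prod>j\<in>UNIV. cubic_spline (y $ j / h $ j)))"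
    by (simp add: tensor_def)
  also have "\<dots> \<le> (\<Sum>j\<in>UNIV. norm (cubic_spline ((0::real^'n) $ j / h $ j) - cubic_spline (y $ j / h $ j)))"
    by (rule norm_prod_diff) (rule le1)+
  also have "\<dots> \<le> (\<Sum>j\<in>UNIV. 1 / (h $ j)\<^sup>2 * (norm y)\<^sup>2)"
  proof (rule sum_mono)
    fix j
    have c0: "cubic_spline 0 = 2/3" by (simp add: cubic_spline_inner)
    have "norm (cubic_spline ((0::real^'n) $ j / h $ j) - cubic_spline (y $ j / h $ j)) \<le> (y $ j / h $ j)\<^sup>2"
      using cubic_spline_drop[of "y $ j / h $ j"] cubic_spline_range[of "y $ j / h $ j"] c0 by simp
    also have "\<dots> = 1 / (h $ j)\<^sup>2 * \<bar>y $ j\<bar>\<^sup>2" by (simp add: power_divide)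
    also have "\<dots> \<le> 1 / (h $ j)\<^sup>2 * (norm y)\<^sup>2"
      using component_le_norm_cart[of y j] by (intro mult_left_mono power_mono) auto
    finally show "norm (cubic_spline ((0::real^'n) $ j / h $ j) - cubic_spline (y $ j / h $ j)) \<le> 1 / (h $ j)\<^sup>2 * (norm y)\<^sup>2" .
  qed
  also have "\<dots> = curv * (norm y)\<^sup>2" by (simp add: curv_def sum_distrib_right)
  finally show ?thesis .
qed

lemma test_fun_hat: "test_fun (\<lambda>x. hat (x - a))"
  by (intro test_fun_shift test_fun_tensor test_fun_tent h_pos)

lemma hat_inner: "(LINT x|lborel. hat (x - a) * hat (x - b)) = cell h * psi (a - b)"
  by (rule tensor_tent_convolution) (rule h_pos)

lemma hat_integrable: "integrable lborel (\<lambda>x. hat (x - a) * hat (x - b))"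
  by (intro test_fun_integrable test_fun_mult test_fun_hat)

lemma hat_increment:
  "integrable lborel (\<lambda>x. (hat (x - a) - hat (x - b))\<^sup>2)"
  "(LINT x|lborel. (hat (x - a) - hat (x - b))\<^sup>2) = 2 * cell h * (psi 0 - psi (a - b))"
proof -
  have e: "(hat (x - a) - hat (x - b))\<^sup>2 = hat (x - a) * hat (x - a) - 2 * (hat (x - a) * hat (x - b)) + hat (x - b) * hat (x - b)" for x
    by (simp add: power2_eq_square algebra_simps)
  show "integrable lborel (\<lambda>x. (hat (x - a) - hat (x - b))\<^sup>2)"
    unfolding e by (simp add: hat_integrable)
  show "(LINT x|lborel. (hat (x - a) - hat (x - b))\<^sup>2) = 2 * cell h * (psi 0 - psi (a - b))"
    unfolding e by (simp add: hat_integrable hat_inner algebra_simps)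
qed

text \<open>Up to sign and the cell volume, the second difference is the correlation of two
  translates of the same hat increment. By 2 a b \<le> a^2 + b^2 it is largest at the origin, where
  it equals 2 (psi 0 - psi s) and \<open>psi_drop\<close> applies. No derivative of the piecewise
  spline is needed.\<close>

lemma psi_second_difference:
  "\<bar>psi (y + s) + psi (y - s) - 2 * psi y\<bar> \<le> 2 * curv * (norm s)\<^sup>2"
proof -
  let ?p = "\<lambda>x. hat (x - (- s)) - hat (x - 0)" and ?q = "\<lambda>x. hat (x - (- y - s)) - hat (x - (- y))"
  have e: "?p x * ?q x = hat (x - (- s)) * hat (x - (- y - s)) - hat (x - (- s)) * hat (x - (- y))
     - hat (x - 0) * hat (x - (- y - s)) + hat (x - 0) * hat (x - (- y))" for x
    by (simp only: algebra_simps)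
  have i: "integrable lborel (\<lambda>x. ?p x * ?q x)"
    unfolding e by (intro Bochner_Integration.integrable_add Bochner_Integration.integrable_diff hat_integrable)
  have "(LINT x|lborel. ?p x * ?q x) = cell h * psi ((- s) - (- y - s)) - cell h * psi ((- s) - (- y))
     - cell h * psi (0 - (- y - s)) + cell h * psi (0 - (- y))"
    unfolding e by (simp only: Bochner_Integration.integral_add Bochner_Integration.integral_diff
        Bochner_Integration.integrable_add Bochner_Integration.integrable_diff hat_integrable hat_inner)
  also have "\<dots> = cell h * (2 * psi y - psi (y + s) - psi (y - s))"
    by (simp add: algebra_simps)
  finally have v: "(LINT x|lborel. ?p x * ?q x) = cell h * (2 * psi y - psi (y + s) - psi (y - s))" .
  have "\<bar>LINT x|lborel. ?p x * ?q x\<bar> \<le> (LINT x|lborel. (?p x)\<^sup>2 / 2 + (?q x)\<^sup>2 / 2)"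
  proof (rule order_trans[OF integral_abs_bound], rule integral_mono)
    show "integrable lborel (\<lambda>x. \<bar>?p x * ?q x\<bar>)" using i by simp
    show "integrable lborel (\<lambda>x. (?p x)\<^sup>2 / 2 + (?q x)\<^sup>2 / 2)"
      by (intro Bochner_Integration.integrable_add integrable_divide hat_increment)
    show "\<bar>?p x * ?q x\<bar> \<le> (?p x)\<^sup>2 / 2 + (?q x)\<^sup>2 / 2" for x
      using sum_squares_bound[of "\<bar>?p x\<bar>" "\<bar>?q x\<bar>"] by (simp add: abs_mult)
  qed
  also have "\<dots> = cell h * (psi 0 - psi ((- s) - 0)) + cell h * (psi 0 - psi ((- y - s) - (- y)))"
    using hat_increment[of "- s" 0] hat_increment[of "- y - s" "- y"] by simp
  also have "\<dots> = cell h * (2 * (psi 0 - psi s))" by (simp add: psi_minus algebra_simps)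
  finally have "cell h * \<bar>2 * psi y - psi (y + s) - psi (y - s)\<bar> \<le> cell h * (2 * (psi 0 - psi s))"
    unfolding v using cell_pos by (simp add: abs_mult)
  then have "\<bar>2 * psi y - psi (y + s) - psi (y - s)\<bar> \<le> 2 * (psi 0 - psi s)"
    using cell_pos by simp
  also have "\<dots> \<le> 2 * curv * (norm s)\<^sup>2" using psi_drop[of s] by simp
  finally show ?thesis by linarith
qed

text \<open>Here the increment is correlated with a full hat. The increment has squared norm of
  order |s|^2 and the hat of order 1, so Young's inequality is weighted by |s| to make both terms of
  order |s|; the weight forces the separate case s = 0.\<close>

lemma psi_lipschitz: "\<bar>psi (y + s) - psi y\<bar> \<le> (curv + 1) * norm s"
proof (cases "s = 0")
  case False
  let ?p = "\<lambda>x. hat (x - s) - hat (x - 0)" and ?q = "\<lambda>x. hat (x - (- y))"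
  let ?r = "norm s"
  have r: "0 < ?r" using False by simp
  have e: "?p x * ?q x = hat (x - s) * hat (x - (- y)) - hat (x - 0) * hat (x - (- y))" for x
    by (simp only: algebra_simps)
  have i: "integrable lborel (\<lambda>x. ?p x * ?q x)"
    unfolding e by (intro Bochner_Integration.integrable_diff hat_integrable)
  have "(LINT x|lborel. ?p x * ?q x) = cell h * psi (s - (- y)) - cell h * psi (0 - (- y))"
    unfolding e by (simp only: Bochner_Integration.integral_diff hat_integrable hat_inner)
  then have v: "(LINT x|lborel. ?p x * ?q x) = cell h * (psi (y + s) - psi y)"
    by (simp add: algebra_simps)
  have q: "integrable lborel (\<lambda>x. (?q x)\<^sup>2)" "(LINT x|lborel. (?q x)\<^sup>2) = cell h * psi 0"
    using hat_integrable[of "- y" "- y"] hat_inner[of "- y" "- y"] by (simp_all add: power2_eq_square)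
  have "\<bar>LINT x|lborel. ?p x * ?q x\<bar> \<le> (LINT x|lborel. (?p x)\<^sup>2 / (2 * ?r) + (?q x)\<^sup>2 * (?r / 2))"
  proof (rule order_trans[OF integral_abs_bound], rule integral_mono)
    show "integrable lborel (\<lambda>x. \<bar>?p x * ?q x\<bar>)" using i by simp
    show "integrable lborel (\<lambda>x. (?p x)\<^sup>2 / (2 * ?r) + (?q x)\<^sup>2 * (?r / 2))"
      by (intro Bochner_Integration.integrable_add integrable_divide integrable_mult_left hat_increment q)
    show "\<bar>?p x * ?q x\<bar> \<le> (?p x)\<^sup>2 / (2 * ?r) + (?q x)\<^sup>2 * (?r / 2)" for x
    proof -
      have "\<bar>a * b\<bar> \<le> a\<^sup>2 / (2 * ?r) + b\<^sup>2 * (?r / 2)" for a b :: real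
        using sum_squares_bound[of "\<bar>a\<bar>" "\<bar>b\<bar> * ?r"] r by (simp add: abs_mult power_mult_distrib field_simps power2_eq_square)
      then show ?thesis .
    qed
  qed
  also have "\<dots> = cell h * ((psi 0 - psi (s - 0)) / ?r + psi 0 * ?r / 2)"
    using hat_increment[of s 0] q r by (simp add: field_simps)
  also have "\<dots> \<le> cell h * (curv * ?r + ?r)"
  proof -
    have "(psi 0 - psi (s - 0)) / ?r \<le> curv * ?r"
      using psi_drop[of s] r by (simp add: psi_minus field_simps power2_eq_square)
    moreover have "psi 0 \<le> 1" unfolding tensor_def using cubic_spline_range
      by (intro prod_le_1) (auto intro: order_trans[OF cubic_spline_range(2)])
    then have "psi 0 * ?r \<le> 1 * ?r" using r by (intro mult_right_mono) auto
    ultimately have "(psi 0 - psi (s - 0)) / ?r + psi 0 * ?r / 2 \<le> curv * ?r + ?r" using r by linarith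
    then show ?thesis using cell_pos by simp
  qed
  finally have "cell h * \<bar>psi (y + s) - psi y\<bar> \<le> cell h * (curv * ?r + ?r)"
    unfolding v using cell_pos by (simp add: abs_mult)
  then have *: "\<bar>psi (y + s) - psi y\<bar> \<le> curv * ?r + ?r" using cell_pos by simp
  then show ?thesis by (simp add: algebra_simps)
qed simp

text \<open>The correlation of the hat interpolant with its own shift, divided by the cell volume,
  as \<open>hat_interp_inner\<close> shows. It is written through \<open>psi\<close> because the
  collocation form appears in this shape.\<close>

definition autocorr :: "(int^'n) set \<Rightarrow> (int^'n \<Rightarrow> real) \<Rightarrow> real^'n \<Rightarrow> real" where
  "autocorr K V s = (\<Sum>j\<in>K. \<Sum>k\<in>K. V j * V k * psi (grid_point h j - grid_point h k + s))"

definition hat_interp :: "(int^'n) set \<Rightarrow> (int^'n \<Rightarrow> real) \<Rightarrow> real^'n \<Rightarrow> real" where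
  "hat_interp K V x = (\<Sum>k\<in>K. V k * hat (x - grid_point h k))"

lemma autocorr_minus: "autocorr K V (- s) = autocorr K V s"
proof -
  have "autocorr K V (- s) = (\<Sum>j\<in>K. \<Sum>k\<in>K. V j * V k * psi (grid_point h k - grid_point h j + s))"
    unfolding autocorr_def by (subst psi_minus[symmetric]) (simp add: algebra_simps)
  also have "\<dots> = autocorr K V s"
    unfolding autocorr_def by (subst sum.swap) (simp add: mult_ac)
  finally show ?thesis .
qed

lemma test_fun_hat_interp: "test_fun (\<lambda>x. hat_interp K V (x - a))"
  unfolding hat_interp_def diff_diff_eq by (intro test_fun_sum test_fun_hat)

lemma hat_interp_integrable: "integrable lborel (\<lambda>x. hat_interp K V (x - a) * hat_interp K V (x - b))"
  by (intro test_fun_integrable test_fun_mult test_fun_hat_interp)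

lemma hat_interp_inner:
  "(LINT x|lborel. hat_interp K V (x - a) * hat_interp K V (x - b)) = cell h * autocorr K V (a - b)"
proof -
  have e: "hat_interp K V (x - a) * hat_interp K V (x - b) =
     (\<Sum>j\<in>K. \<Sum>k\<in>K. V j * V k * (hat (x - (a + grid_point h j)) * hat (x - (b + grid_point h k))))" for x
    unfolding hat_interp_def sum_product diff_diff_eq by (intro sum.cong refl) (simp only: mult_ac)
  have "(LINT x|lborel. hat_interp K V (x - a) * hat_interp K V (x - b)) =
     (\<Sum>j\<in>K. \<Sum>k\<in>K. V j * V k * (cell h * psi ((a + grid_point h j) - (b + grid_point h k))))"
    unfolding e by (simp add: hat_integrable hat_inner)
  also have "\<dots> = cell h * autocorr K V (a - b)"
    unfolding autocorr_def sum_distrib_left by (intro sum.cong refl) (simp add: algebra_simps)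
  finally show ?thesis .
qed

lemma autocorr_zero_nonneg: "0 \<le> autocorr K V 0"
proof -
  have "0 \<le> (LINT x|lborel. hat_interp K V (x - 0) * hat_interp K V (x - 0))" by simp
  then show ?thesis unfolding hat_interp_inner using cell_pos by (simp add: zero_le_mult_iff)
qed

lemma hat_interp_increment:
  "integrable lborel (\<lambda>x. (hat_interp K V (x - a) - hat_interp K V (x - b))\<^sup>2)"
  "(LINT x|lborel. (hat_interp K V (x - a) - hat_interp K V (x - b))\<^sup>2) = 2 * cell h * (autocorr K V 0 - autocorr K V (a - b))"
proof -
  let ?w = "hat_interp K V"
  have e: "(?w (x - a) - ?w (x - b))\<^sup>2 = ?w (x - a) * ?w (x - a) - 2 * (?w (x - a) * ?w (x - b)) + ?w (x - b) * ?w (x - b)" for x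
    by (simp add: power2_eq_square algebra_simps)
  show "integrable lborel (\<lambda>x. (?w (x - a) - ?w (x - b))\<^sup>2)"
    unfolding e by (simp add: hat_interp_integrable)
  show "(LINT x|lborel. (?w (x - a) - ?w (x - b))\<^sup>2) = 2 * cell h * (autocorr K V 0 - autocorr K V (a - b))"
    unfolding e by (simp add: hat_interp_integrable hat_interp_inner algebra_simps)
qed

text \<open>A shift by n s is a sum of n increments. Cauchy-Schwarz costs one factor n, and
  translation invariance makes the n increments equal in norm, which costs the other.\<close>

lemma autocorr_telescope:
  "autocorr K V 0 - autocorr K V (real n *\<^sub>R s) \<le> (real n)\<^sup>2 * (autocorr K V 0 - autocorr K V s)"
proof -
  let ?w = "hat_interp K V"
  let ?d = "\<lambda>i x. ?w (x - real (Suc i) *\<^sub>R s) - ?w (x - real i *\<^sub>R s)"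
  have inc: "(LINT x|lborel. (?d i x)\<^sup>2) = 2 * cell h * (autocorr K V 0 - autocorr K V s)" for i
    by (subst hat_interp_increment) (simp add: algebra_simps)
  have "2 * cell h * (autocorr K V 0 - autocorr K V (real n *\<^sub>R s - 0)) = (LINT x|lborel. (?w (x - real n *\<^sub>R s) - ?w (x - 0))\<^sup>2)"
    by (simp only: hat_interp_increment)
  also have "\<dots> \<le> (LINT x|lborel. real n * (\<Sum>i<n. (?d i x)\<^sup>2))"
  proof (rule integral_mono)
    show "(?w (x - real n *\<^sub>R s) - ?w (x - 0))\<^sup>2 \<le> real n * (\<Sum>i<n. (?d i x)\<^sup>2)" for x
    proof -
      have "(?w (x - real n *\<^sub>R s) - ?w (x - 0)) = (\<Sum>i<n. ?d i x)"
        by (subst sum_lessThan_telescope) simp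
      then show ?thesis
        using sum_squared_le_sum_of_squares[of "\<lambda>i. ?d i x" "{..<n}"] by (simp add: mult.commute)
    qed
  qed (intro hat_interp_increment Bochner_Integration.integrable_sum integrable_mult_right)+
  also have "\<dots> = real n * (\<Sum>i<n. LINT x|lborel. (?d i x)\<^sup>2)"
    by (simp only: integral_mult_right_zero Bochner_Integration.integral_sum hat_interp_increment)
  also have "\<dots> = 2 * cell h * ((real n)\<^sup>2 * (autocorr K V 0 - autocorr K V s))"
    unfolding inc by (simp add: power2_eq_square)
  finally show ?thesis using cell_pos by simp
qed

text \<open>At shift 0 the autocorrelation is the squared L2 norm of the hat interpolant per cell
  volume, so the hat duals recover the coefficients from it.\<close>

lemma autocorr_zero_lower:
  assumes "finite K"
  shows "(\<Sum>k\<in>K. (V k)\<^sup>2) \<le> 4 ^ CARD('n) * autocorr K V 0"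
proof -
  have "cell h * (\<Sum>k\<in>K. (norm (V k))\<^sup>2) \<le> 4 ^ CARD('n) *
     (LINT x|lborel. (norm (\<Sum>k\<in>K. hat (x - grid_point h k) *\<^sub>R V k))\<^sup>2)"
  proof (rule riesz_lower_bound[OF assms, where g = "\<lambda>k x. tensor h tent_dual (x - grid_point h k)"])
    show "(LINT x|lborel. hat (x - grid_point h j) * tensor h tent_dual (x - grid_point h k)) = (if j = k then cell h else 0)" for j k
      by (subst tensor_lattice_inner[OF test_fun_tent test_fun_tent_dual h_pos tent_dual_duality]) simp
    show "(LINT x|lborel. tensor h tent_dual (x - grid_point h j) * tensor h tent_dual (x - grid_point h k)) = (if j = k then cell h * 4 ^ CARD('n) else 0)" for j k
      by (rule tensor_lattice_inner[OF test_fun_tent_dual test_fun_tent_dual h_pos tent_dual_orthogonal])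
  qed (auto intro!: test_fun_hat test_fun_shift test_fun_tensor test_fun_tent_dual h_pos)
  also have "(LINT x|lborel. (norm (\<Sum>k\<in>K. hat (x - grid_point h k) *\<^sub>R V k))\<^sup>2) =
      (LINT x|lborel. hat_interp K V (x - 0) * hat_interp K V (x - 0))"
    by (simp add: hat_interp_def power2_eq_square mult.commute)
  also have "\<dots> = cell h * autocorr K V 0" by (simp only: hat_interp_inner diff_self)
  finally show ?thesis using cell_pos by simp
qed

text \<open>The Poincare inequality: after enough steps along s the interpolant no longer correlates
  with its shift, so telescoping bounds the full norm by one increment. In D, 2 R bounds the
  distance of two grid points and twice the sum of the h_j is the range of
  \<open>psi\<close>.\<close>

lemma autocorr_coercive:
  assumes K: "finite K" and R: "\<And>k. k \<in> K \<Longrightarrow> norm (grid_point h k) \<le> R"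
    and D: "2 * R + 2 * (\<Sum>j\<in>UNIV. h $ j) \<le> D" "0 < D" and s: "0 < norm s" "norm s \<le> \<delta>"
  shows "(norm s)\<^sup>2 * (\<Sum>k\<in>K. (V k)\<^sup>2) \<le> 4 ^ CARD('n) * (D + \<delta>)\<^sup>2 * (autocorr K V 0 - autocorr K V s)"
proof -
  \<comment> \<open>Rounding up overshoots D by at most one step, of length |s| \<le> \<delta>; this
    is the origin of D + \<delta>.\<close>
  define n where "n = nat \<lceil>D / norm s\<rceil>"
  have n: "D / norm s \<le> real n" "real n \<le> D / norm s + 1"
    using D s by (auto simp: n_def)
  have n1: "D \<le> real n * norm s" and n2: "real n * norm s \<le> D + \<delta>"
    using n s by (auto simp: field_simps)
  have "psi (grid_point h j - grid_point h k + real n *\<^sub>R s) = 0" if "j \<in> K" "k \<in> K" for j k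
  proof (rule psi_zero)
    have "real n * norm s = norm ((grid_point h j - grid_point h k + real n *\<^sub>R s) - grid_point h j + grid_point h k)" by simp
    also have "\<dots> \<le> norm (grid_point h j - grid_point h k + real n *\<^sub>R s) + norm (grid_point h j) + norm (grid_point h k)"
      by (rule order_trans[OF norm_triangle_ineq add_right_mono[OF norm_triangle_ineq4]])
    finally show "2 * (\<Sum>j\<in>UNIV. h $ j) \<le> norm (grid_point h j - grid_point h k + real n *\<^sub>R s)"
      using R[OF that(1)] R[OF that(2)] n1 D by linarith
  qed
  then have "autocorr K V (real n *\<^sub>R s) = 0" unfolding autocorr_def by (auto intro!: sum.neutral)
  then have a: "autocorr K V 0 \<le> (real n)\<^sup>2 * (autocorr K V 0 - autocorr K V s)"
    using autocorr_telescope[of K V n s] by simp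
  \<comment> \<open>The sign is needed to replace n |s| by D + \<delta> below; it follows from the
    telescoped bound because n > 0.\<close>
  have A: "0 \<le> autocorr K V 0 - autocorr K V s"
    using autocorr_zero_nonneg[of K V] a
    by (cases "n = 0") (use n1 D in \<open>auto simp: zero_le_mult_iff dest: order_trans[of 0 "autocorr K V 0"]\<close>)
  have "(norm s)\<^sup>2 * (\<Sum>k\<in>K. (V k)\<^sup>2) \<le> (norm s)\<^sup>2 * (4 ^ CARD('n) * autocorr K V 0)"
    by (intro mult_left_mono autocorr_zero_lower K) simp
  also have "\<dots> \<le> (norm s)\<^sup>2 * (4 ^ CARD('n) * ((real n)\<^sup>2 * (autocorr K V 0 - autocorr K V s)))"
    by (intro mult_left_mono a) auto
  also have "\<dots> = 4 ^ CARD('n) * ((real n * norm s)\<^sup>2 * (autocorr K V 0 - autocorr K V s))"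
    by (simp add: power_mult_distrib)
  also have "\<dots> \<le> 4 ^ CARD('n) * ((D + \<delta>)\<^sup>2 * (autocorr K V 0 - autocorr K V s))"
    using n2 A by (intro mult_left_mono mult_right_mono power_mono) auto
  finally show ?thesis by simp
qed

end

section \<open>The kernel and the principal value\<close>

text \<open>Applied with c = \<delta> for the scaling of moments and with c = -1 for reflections s
  \<mapsto> -s.\<close>

lemma lborel_integral_scaleR:
  fixes f :: "'a::euclidean_space \<Rightarrow> 'b::euclidean_space"
  assumes c: "c \<noteq> 0" and f [measurable]: "f \<in> borel_measurable borel"
  shows "integrable lborel (\<lambda>x. f (c *\<^sub>R x)) \<longleftrightarrow> integrable lborel f" (is ?i)
    and "(LINT x|lborel. f (c *\<^sub>R x)) = (LINT x|lborel. f x) /\<^sub>R \<bar>c\<bar> ^ DIM('a)" (is ?e)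
proof -
  have D: "(lborel :: 'a measure) = density (distr lborel borel (\<lambda>x. 0 + c *\<^sub>R x)) (\<lambda>_. ennreal (\<bar>c\<bar> ^ DIM('a)))"
    using lborel_affine[OF c, of 0] by simp
  have "integrable lborel f \<longleftrightarrow> integrable (density (distr lborel borel (\<lambda>x::'a. 0 + c *\<^sub>R x)) (\<lambda>_. ennreal (\<bar>c\<bar> ^ DIM('a)))) f"
    by (subst D) simp
  also have "\<dots> \<longleftrightarrow> integrable lborel (\<lambda>x. \<bar>c\<bar> ^ DIM('a) *\<^sub>R f (c *\<^sub>R x))"
    by (subst integrable_density) (simp_all add: integrable_distr_eq)
  also have "\<dots> \<longleftrightarrow> integrable lborel (\<lambda>x. f (c *\<^sub>R x))"
  proof
    assume "integrable lborel (\<lambda>x. \<bar>c\<bar> ^ DIM('a) *\<^sub>R f (c *\<^sub>R x))"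
    then have "integrable lborel (\<lambda>x. inverse (\<bar>c\<bar> ^ DIM('a)) *\<^sub>R \<bar>c\<bar> ^ DIM('a) *\<^sub>R f (c *\<^sub>R x))"
      by (rule integrable_scaleR_right)
    then show "integrable lborel (\<lambda>x. f (c *\<^sub>R x))" using c by simp
  qed (rule integrable_scaleR_right)
  finally show ?i by simp
  have "(LINT x|lborel. f x) = (LINT x|density (distr lborel borel (\<lambda>x::'a. 0 + c *\<^sub>R x)) (\<lambda>_. ennreal (\<bar>c\<bar> ^ DIM('a))). f x)"
    by (subst D) simp
  also have "\<dots> = (LINT x|lborel. \<bar>c\<bar> ^ DIM('a) *\<^sub>R f (c *\<^sub>R x))"
    by (subst integral_density) (simp_all add: integral_distr)
  finally show ?e using c by simp
qed

text \<open>Sign and monotonicity concern positive radii, which leaves \<open>\<rho> 0\<close>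
  arbitrary, as suits singular kernels. The \<open>itself\<close> parameter ties the dimension to a
  function that does not mention it.\<close>

locale kernel =
  fixes \<rho> :: "real \<Rightarrow> real" and dim :: "'n::finite itself"
  assumes rho_nonneg: "\<And>r. 0 < r \<Longrightarrow> 0 \<le> \<rho> r"
    and rho_antimono: "\<And>r t. 0 < r \<Longrightarrow> r \<le> t \<Longrightarrow> \<rho> t \<le> \<rho> r"
    and rho_normalized: "(LINT s:ball (0::real^'n) 1|lborel. \<rho> (norm s) * (norm s)\<^sup>2) = real CARD('n)"
begin

text \<open>The cut-off is part of the function, so that the operators become integrals over the
  whole space, on which scaling and reflection act freely.\<close>

definition ker :: "real \<Rightarrow> real^'n \<Rightarrow> real" where
  "ker \<delta> s = indicator (ball 0 \<delta>) s * kernel_scaled \<rho> \<delta> s"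

text \<open>A monotone profile on the positive half line is Borel there; the origin is patched in as
  a single point.\<close>

lemma ker_measurable [measurable]:
  assumes "0 < \<delta>"
  shows "ker \<delta> \<in> borel_measurable borel"
proof -
  have "mono_on {0<..} (\<lambda>r. - \<rho> r)"
    by (auto intro!: mono_onI rho_antimono)
  then have "(\<lambda>r. - \<rho> r) \<in> borel_measurable (restrict_space borel {0<..})"
    by (rule borel_measurable_mono_on_fnc)
  then have [measurable]: "(\<lambda>r. indicator {0<..} r *\<^sub>R (- \<rho> r)) \<in> borel_measurable borel"
    by (subst (asm) borel_measurable_restrict_space_iff) auto
  have "(\<lambda>s::real^'n. \<rho> (norm s / \<delta>)) =
      (\<lambda>s. if s = 0 then \<rho> 0 else - (indicator {0<..} (norm s / \<delta>) *\<^sub>R (- \<rho> (norm s / \<delta>))))"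
    using assms by (auto simp: fun_eq_iff)
  also have "\<dots> \<in> borel_measurable borel"
    by (intro measurable_If borel_measurable_uminus measurable_compose[OF _ \<open>(\<lambda>r. indicator {0<..} r *\<^sub>R (- \<rho> r)) \<in> borel_measurable borel\<close>]) measurable
  finally have [measurable]: "(\<lambda>s::real^'n. \<rho> (norm s / \<delta>)) \<in> borel_measurable borel" .
  show ?thesis unfolding ker_def[abs_def] kernel_scaled_def
    by (intro borel_measurable_times borel_measurable_indicator borel_measurable_divide
        borel_measurable_const borel_open open_ball) fact
qed

lemma ker_minus: "ker \<delta> (- s) = ker \<delta> s"
  by (simp add: ker_def kernel_scaled_def indicator_def)

lemma ker_nonneg: "0 < \<delta> \<Longrightarrow> s \<noteq> 0 \<Longrightarrow> 0 \<le> ker \<delta> s"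
  unfolding ker_def kernel_scaled_def by (intro mult_nonneg_nonneg divide_nonneg_nonneg rho_nonneg) auto

lemma ker_scale: "0 < \<delta> \<Longrightarrow> ker \<delta> (\<delta> *\<^sub>R s) = ker 1 s / \<delta> ^ (CARD('n) + 2)"
  by (simp add: ker_def kernel_scaled_def indicator_def)

text \<open>Integrability is hidden in the normalization: a non-integrable function has Bochner
  integral 0, whereas this one has a positive integral.\<close>

lemma ker_one_moment:
  "integrable lborel (\<lambda>s. ker 1 s * (norm s)\<^sup>2)" "(LINT s|lborel. ker 1 s * (norm s)\<^sup>2) = real CARD('n)"
proof -
  have e: "(LINT s|lborel. ker 1 s * (norm s)\<^sup>2) = real CARD('n)"
    using rho_normalized by (simp add: set_lebesgue_integral_def ker_def kernel_scaled_def mult.assoc)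
  show "(LINT s|lborel. ker 1 s * (norm s)\<^sup>2) = real CARD('n)" by fact
  show "integrable lborel (\<lambda>s. ker 1 s * (norm s)\<^sup>2)"
    using e not_integrable_integral_eq by fastforce
qed

lemma ker_integrable:
  assumes "0 < \<delta>"
  shows "integrable lborel (\<lambda>s. ker \<delta> s * (norm s)\<^sup>2)"
proof -
  note [measurable] = ker_measurable[OF assms]
  have "integrable lborel (\<lambda>s. ker 1 s * (norm s)\<^sup>2 / \<delta> ^ CARD('n))"
    using ker_one_moment by simp
  also have "(\<lambda>s. ker 1 s * (norm s)\<^sup>2 / \<delta> ^ CARD('n)) = (\<lambda>s. ker \<delta> (\<delta> *\<^sub>R s) * (norm (\<delta> *\<^sub>R s))\<^sup>2)"
    using assms by (simp add: ker_scale fun_eq_iff power_mult_distrib power_add power2_eq_square)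
  finally show ?thesis using assms
    by (subst (asm) lborel_integral_scaleR(1)[where f = "\<lambda>s. ker \<delta> s * (norm s)\<^sup>2"]) auto
qed

lemma ker_dominated:
  fixes f :: "real^'n \<Rightarrow> 'b::euclidean_space"
  assumes "0 < \<delta>" and [measurable]: "f \<in> borel_measurable borel"
    and f: "\<And>s. norm (f s) \<le> C * \<bar>ker \<delta> s * (norm s)\<^sup>2\<bar>"
  shows "integrable lborel f"
proof (rule Bochner_Integration.integrable_bound)
  show "integrable lborel (\<lambda>s. C * \<bar>ker \<delta> s * (norm s)\<^sup>2\<bar>)"
    using ker_integrable[OF assms(1)] by simp
  show "AE s in lborel. norm (f s) \<le> norm (C * \<bar>ker \<delta> s * (norm s)\<^sup>2\<bar>)"
    using f by (intro AE_I2) (auto intro: order_trans[OF _ abs_ge_self])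
qed simp

lemma ker_inner_integrable:
  assumes "0 < \<delta>"
  shows "integrable lborel (\<lambda>s. ker \<delta> s * ((s \<bullet> a) * (s \<bullet> b)))"
proof (rule ker_dominated[OF assms])
  note [measurable] = ker_measurable[OF assms]
  show "(\<lambda>s. ker \<delta> s * ((s \<bullet> a) * (s \<bullet> b))) \<in> borel_measurable borel" by measurable
  show "norm (ker \<delta> s * ((s \<bullet> a) * (s \<bullet> b))) \<le> (norm a * norm b) * \<bar>ker \<delta> s * (norm s)\<^sup>2\<bar>" for s
  proof -
    have "\<bar>s \<bullet> a\<bar> * \<bar>s \<bullet> b\<bar> \<le> (norm s * norm a) * (norm s * norm b)"
      by (intro mult_mono Cauchy_Schwarz_ineq2) auto
    from mult_left_mono[OF this, of "\<bar>ker \<delta> s\<bar>"] show ?thesis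
      by (simp add: abs_mult power2_eq_square mult_ac)
  qed
qed

text \<open>The exponent CARD('n) + 2 in \<open>kernel_scaled\<close> is made for this: CARD('n)
  powers of \<delta> come from the volume and two from the squared length. All uniformity in
  \<delta> rests here.\<close>

lemma ker_moment_scale:
  assumes "0 < \<delta>"
  shows "(LINT s|lborel. ker \<delta> s * (s \<bullet> a)\<^sup>2) = (LINT s|lborel. ker 1 s * (s \<bullet> a)\<^sup>2)"
proof -
  note [measurable] = ker_measurable[OF assms]
  have "(LINT s|lborel. ker \<delta> (\<delta> *\<^sub>R s) * ((\<delta> *\<^sub>R s) \<bullet> a)\<^sup>2) = (LINT s|lborel. ker \<delta> s * (s \<bullet> a)\<^sup>2) / \<delta> ^ CARD('n)"
    using assms by (subst lborel_integral_scaleR(2)[where f = "\<lambda>s. ker \<delta> s * (s \<bullet> a)\<^sup>2"]) (auto simp: field_simps)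
  moreover have "(LINT s|lborel. ker \<delta> (\<delta> *\<^sub>R s) * ((\<delta> *\<^sub>R s) \<bullet> a)\<^sup>2) = (LINT s|lborel. ker 1 s * (s \<bullet> a)\<^sup>2 / \<delta> ^ CARD('n))"
    using assms by (intro Bochner_Integration.integral_cong refl)
      (simp add: ker_scale power_mult_distrib power_add power2_eq_square)
  ultimately show ?thesis using assms by simp
qed

text \<open>If the moment vanished, the kernel would vanish almost everywhere off the hyperplane
  orthogonal to a, which is a null set, and the normalization would fail.\<close>

lemma ker_moment_pos:
  assumes "a \<noteq> 0"
  shows "0 < (LINT s|lborel. ker 1 s * (s \<bullet> a)\<^sup>2)"
proof -
  have nn: "0 \<le> ker 1 s * (s \<bullet> a)\<^sup>2" for s
    using ker_nonneg[of 1 s] by (cases "s = 0") auto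
  have int: "integrable lborel (\<lambda>s. ker 1 s * (s \<bullet> a)\<^sup>2)"
    using ker_inner_integrable[of 1 a a] by (simp add: power2_eq_square)
  have "(LINT s|lborel. ker 1 s * (s \<bullet> a)\<^sup>2) \<noteq> 0"
  proof
    assume "(LINT s|lborel. ker 1 s * (s \<bullet> a)\<^sup>2) = 0"
    then have 1: "AE s in lborel. ker 1 s * (s \<bullet> a)\<^sup>2 = 0"
      using integral_nonneg_eq_0_iff_AE[OF int] nn by auto
    have "negligible {s. a \<bullet> s = 0}" using assms by (intro negligible_hyperplane) simp
    then have "AE s in lebesgue. \<not> a \<bullet> s = 0"
      by (auto simp: negligible_iff_null_sets dest: AE_not_in)
    then have 2: "AE s in lborel. a \<bullet> s \<noteq> 0"
      by (simp add: AE_completion_iff)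
    have "AE s in lborel. ker 1 s * (norm s)\<^sup>2 = 0"
      using 1 2 by eventually_elim (auto simp: inner_commute)
    then have "(LINT s|lborel. ker 1 s * (norm s)\<^sup>2) = 0"
      by (rule integral_eq_zero_AE)
    then show False using ker_one_moment by simp
  qed
  moreover have "0 \<le> (LINT s|lborel. ker 1 s * (s \<bullet> a)\<^sup>2)" using nn by simp
  ultimately show ?thesis by simp
qed

text \<open>As a quadratic form in a the moment is continuous, so it attains a positive minimum on
  the unit sphere; homogeneity and \<open>ker_moment_scale\<close> extend the bound to all a and
  \<delta>.\<close>

lemma ker_moment_lower:
  obtains c where "0 < c" "\<And>\<delta> a. 0 < \<delta> \<Longrightarrow> c * (norm a)\<^sup>2 \<le> (LINT s|lborel. ker \<delta> s * (s \<bullet> a)\<^sup>2)"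
proof -
  define m where "m a = (LINT s|lborel. ker 1 s * (s \<bullet> a)\<^sup>2)" for a
  have mq: "m a = (\<Sum>i\<in>UNIV. \<Sum>j\<in>UNIV. a $ i * a $ j * (LINT s|lborel. ker 1 s * ((s \<bullet> axis i 1) * (s \<bullet> axis j 1))))" for a
  proof -
    have "ker 1 s * (s \<bullet> a)\<^sup>2 = (\<Sum>i\<in>UNIV. \<Sum>j\<in>UNIV. a $ i * a $ j * (ker 1 s * ((s \<bullet> axis i 1) * (s \<bullet> axis j 1))))" for s
      by (simp add: inner_vec_def[of s a] power2_eq_square sum_product sum_distrib_left inner_axis mult_ac)
    then show ?thesis unfolding m_def by (simp add: ker_inner_integrable)
  qed
  have "continuous_on (sphere 0 1) m" unfolding mq by (intro continuous_intros)
  moreover have "sphere (0::real^'n) 1 \<noteq> {}" by simp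
  ultimately obtain b where b: "b \<in> sphere 0 1" "\<And>a. a \<in> sphere 0 1 \<Longrightarrow> m b \<le> m a"
    using continuous_attains_inf[OF compact_sphere] by metis
  show ?thesis
  proof
    show "0 < m b" unfolding m_def using b by (intro ker_moment_pos) auto
    show "m b * (norm a)\<^sup>2 \<le> (LINT s|lborel. ker \<delta> s * (s \<bullet> a)\<^sup>2)" if "0 < \<delta>" for \<delta> a
    proof (cases "a = 0")
      case False
      have "m a = (norm a)\<^sup>2 * m (a /\<^sub>R norm a)"
        unfolding m_def using False by (simp add: power_mult_distrib power_divide field_simps)
      moreover have "m b \<le> m (a /\<^sub>R norm a)" using False by (intro b(2)) simp
      ultimately have "m b * (norm a)\<^sup>2 \<le> m a"
        using mult_right_mono[of "m b" "m (a /\<^sub>R norm a)" "(norm a)\<^sup>2"] by (simp add: mult.commute)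
      then show ?thesis using ker_moment_scale[OF that] by (simp add: m_def)
    qed simp
  qed
qed

text \<open>Averaging over s and -s turns the first difference into a second difference of order
  |s|^2, so the symmetrized integrand is dominated by the integrable second moment. Truncations are
  symmetric balls, hence unaffected by the averaging, and dominated convergence removes
  them.\<close>

lemma nl_bond_eq:
  fixes u :: "real^'n \<Rightarrow> real^'n"
  assumes \<delta>: "0 < \<delta>" and u [measurable]: "u \<in> borel_measurable borel"
    and lip: "\<And>s. norm (u (x + s) - u x) \<le> L * norm s"
    and second: "\<And>s. norm (u (x + s) + u (x - s) - 2 *\<^sub>R u x) \<le> C * (norm s)\<^sup>2"
  defines "f \<equiv> \<lambda>s. (ker \<delta> s * (s \<bullet> (u (x + s) + u (x - s) - 2 *\<^sub>R u x)) / (2 * (norm s)\<^sup>2)) *\<^sub>R s"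
  shows "integrable lborel f" "nl_bond \<rho> \<delta> u x = (LINT s|lborel. f s)"
proof -
  note [measurable] = ker_measurable[OF \<delta>]
  have f [measurable]: "f \<in> borel_measurable borel" unfolding f_def by measurable
  have f_bound: "norm (f s) \<le> C / 2 * \<bar>ker \<delta> s * (norm s)\<^sup>2\<bar>" for s
  proof (cases "s = 0")
    case False
    let ?w = "u (x + s) + u (x - s) - 2 *\<^sub>R u x"
    have "\<bar>s \<bullet> ?w\<bar> \<le> norm s * (C * (norm s)\<^sup>2)"
      using order_trans[OF Cauchy_Schwarz_ineq2 mult_left_mono[OF second]] by simp
    then have "\<bar>ker \<delta> s\<bar> * \<bar>s \<bullet> ?w\<bar> \<le> \<bar>ker \<delta> s\<bar> * (norm s * (C * (norm s)\<^sup>2))"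
      by (intro mult_left_mono) auto
    then show ?thesis using False
      by (simp add: f_def abs_mult power2_eq_square field_simps)
  qed (simp add: f_def)
  show int: "integrable lborel f" by (rule ker_dominated[OF \<delta> f f_bound])
  let ?I = "\<lambda>\<epsilon> s. indicator (- ball 0 \<epsilon>) s :: real"
  have tr: "(LINT s:(ball 0 \<delta> - ball 0 \<epsilon>)|lborel. kernel_scaled \<rho> \<delta> s *\<^sub>R (((s \<bullet> (u (x + s) - u x)) / (norm s)\<^sup>2) *\<^sub>R s))
     = (LINT s|lborel. ?I \<epsilon> s *\<^sub>R f s)" if \<epsilon>: "0 < \<epsilon>" for \<epsilon>
  proof -
    define g where "g s = (?I \<epsilon> s * ker \<delta> s * (s \<bullet> (u (x + s) - u x)) / (norm s)\<^sup>2) *\<^sub>R s" for s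
    have g [measurable]: "g \<in> borel_measurable borel" unfolding g_def by measurable
    have gb: "norm (g s) \<le> L / \<epsilon> * \<bar>ker \<delta> s * (norm s)\<^sup>2\<bar>" for s
    proof (cases "norm s < \<epsilon>")
      case False
      then have s: "\<epsilon> \<le> norm s" "s \<noteq> 0" using \<epsilon> by auto
      let ?w = "u (x + s) - u x"
      have L: "0 \<le> L" using order_trans[OF norm_ge_zero lip[of s]] s by (simp add: zero_le_mult_iff)
      have "\<bar>s \<bullet> ?w\<bar> \<le> norm s * (L * norm s)"
        using order_trans[OF Cauchy_Schwarz_ineq2 mult_left_mono[OF lip]] by simp
      \<comment> \<open>Outside the ball of radius \<epsilon> the factor |s| / \<epsilon> \<ge> 1
        supplies the power of |s| that a Lipschitz bound alone lacks.\<close>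
      also have "\<dots> \<le> norm s * (L * norm s) * (norm s / \<epsilon>)"
        using s \<epsilon> L mult_left_mono[of 1 "norm s / \<epsilon>" "norm s * (L * norm s)"] by simp
      finally have "\<bar>ker \<delta> s\<bar> * \<bar>s \<bullet> ?w\<bar> / norm s \<le> \<bar>ker \<delta> s\<bar> * (norm s * (L * norm s) * (norm s / \<epsilon>)) / norm s"
        by (intro divide_right_mono mult_left_mono) auto
      moreover have "norm (g s) = \<bar>ker \<delta> s\<bar> * \<bar>s \<bullet> ?w\<bar> / norm s"
        using s by (simp add: g_def abs_mult power2_eq_square)
      moreover have "\<bar>ker \<delta> s\<bar> * (norm s * (L * norm s) * (norm s / \<epsilon>)) / norm s = L / \<epsilon> * \<bar>ker \<delta> s * (norm s)\<^sup>2\<bar>"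
        using s by (simp add: abs_mult power2_eq_square)
      ultimately show ?thesis by simp
    next
      case True
      \<comment> \<open>Here the integrand is 0, but its majorant must still be nonnegative; a unit
        vector in the Lipschitz bound shows that it is.\<close>
      have "0 \<le> L"
      proof (rule ccontr)
        assume "\<not> 0 \<le> L"
        then show False using lip[of "axis undefined 1"] norm_ge_zero[of "u (x + axis undefined 1) - u x"] by simp
      qed
      with True \<epsilon> show ?thesis by (simp add: g_def)
    qed
    have ig: "integrable lborel g" by (rule ker_dominated[OF \<delta> g gb])
    have ig': "integrable lborel (\<lambda>s. g (- s))" and e: "(LINT s|lborel. g (- s)) = (LINT s|lborel. g s)"
      using lborel_integral_scaleR[of "-1" g, OF _ g] ig by simp_all
    have "?I \<epsilon> s *\<^sub>R f s = (1/2) *\<^sub>R (g s + g (- s))" for s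
    proof -
      have I: "?I \<epsilon> (- s) = ?I \<epsilon> s" by (simp add: indicator_def)
      have "s \<bullet> (u (x + s) + u (x - s) - 2 *\<^sub>R u x) = s \<bullet> (u (x + s) - u x) + s \<bullet> (u (x - s) - u x)"
        by (simp add: inner_simps)
      then show ?thesis unfolding f_def g_def
        by (simp add: I ker_minus ring_distribs add_divide_distrib scaleR_left_distrib
            flip: scaleR_left_distrib) 
    qed
    then have "(LINT s|lborel. ?I \<epsilon> s *\<^sub>R f s) = (1/2) *\<^sub>R ((LINT s|lborel. g s) + (LINT s|lborel. g (- s)))"
      using ig ig' by simp
    also have "\<dots> = (LINT s|lborel. g s)" unfolding e by (simp flip: scaleR_2)
    also have "\<dots> = (LINT s:(ball 0 \<delta> - ball 0 \<epsilon>)|lborel. kernel_scaled \<rho> \<delta> s *\<^sub>R (((s \<bullet> (u (x + s) - u x)) / (norm s)\<^sup>2) *\<^sub>R s))"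
      unfolding set_lebesgue_integral_def g_def ker_def
      by (intro Bochner_Integration.integral_cong refl) (auto simp: indicator_def)
    finally show ?thesis ..
  qed
  \<comment> \<open>With \<epsilon> = 1 / t the limit becomes one at infinity, where dominated
    convergence for a real parameter is available. For each s \<noteq> 0 the cut-off is eventually
    1.\<close>
  have "((\<lambda>\<epsilon>. LINT s|lborel. ?I \<epsilon> s *\<^sub>R f s) \<longlongrightarrow> (LINT s|lborel. f s)) (at_right 0)"
    unfolding filterlim_at_right_to_top
  proof (rule integral_dominated_convergence_at_top)
    show "integrable lborel (\<lambda>s. norm (f s))" using int by simp
    show "\<forall>\<^sub>F t in at_top. AE s in lborel. norm (?I (inverse t) s *\<^sub>R f s) \<le> norm (f s)"
      by (intro always_eventually allI AE_I2) (simp add: indicator_def)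
    show "AE s in lborel. ((\<lambda>t. ?I (inverse t) s *\<^sub>R f s) \<longlongrightarrow> f s) at_top"
    proof (intro AE_I2 tendsto_eventually)
      fix s
      show "\<forall>\<^sub>F t in at_top. ?I (inverse t) s *\<^sub>R f s = f s"
      proof (cases "s = 0")
        case False
        have "?I (inverse t) s *\<^sub>R f s = f s" if "inverse (norm s) \<le> t" for t
        proof -
          have "inverse t \<le> norm s" using that False
            by (metis inverse_inverse_eq le_imp_inverse_le positive_imp_inverse_positive zero_less_norm_iff)
          then show ?thesis by (simp add: indicator_def)
        qed
        then show ?thesis unfolding eventually_at_top_linorder by blast
      qed (simp add: f_def)
    qed
  qed measurable
  then have "((\<lambda>\<epsilon>. LINT s:(ball 0 \<delta> - ball 0 \<epsilon>)|lborel. kernel_scaled \<rho> \<delta> s *\<^sub>R (((s \<bullet> (u (x + s) - u x)) / (norm s)\<^sup>2) *\<^sub>R s))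
      \<longlongrightarrow> (LINT s|lborel. f s)) (at_right 0)"
    by (rule Lim_transform_eventually) (rule eventually_mono[OF eventually_at_right_less], simp only: tr)
  then show "nl_bond \<rho> \<delta> u x = (LINT s|lborel. f s)"
    unfolding nl_bond_def by (intro tendsto_Lim) simp_all
qed

end

section \<open>Coercivity of the collocation forms\<close>

lemma finite_vec_box:
  fixes S :: "'n::finite \<Rightarrow> 'a set"
  assumes "\<And>i. finite (S i)"
  shows "finite {k :: 'a^'n. \<forall>i. k $ i \<in> S i}"
proof (rule finite_subset)
  show "{k :: 'a^'n. \<forall>i. k $ i \<in> S i} \<subseteq> vec_lambda ` (PiE UNIV S)"
  proof
    fix k :: "'a^'n" assume "k \<in> {k. \<forall>i. k $ i \<in> S i}"
    then show "k \<in> vec_lambda ` (PiE UNIV S)"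
      by (intro image_eqI[of _ _ "vec_nth k"]) (auto simp: vec_nth_inverse)
  qed
  show "finite (vec_lambda ` (PiE UNIV S))" using assms by (intro finite_imageI finite_PiE) auto
qed

section \<open>Spline functions with finitely many coefficients and their norms\<close>

context grid
begin

definition lattice_fun :: "(int^'n) set \<Rightarrow> (int^'n \<Rightarrow> 'b::real_normed_vector) \<Rightarrow> real^'n \<Rightarrow> 'b" where
  "lattice_fun K U x = (\<Sum>k\<in>K. psi (x - grid_point h k) *\<^sub>R U k)"

lemma rk_interp_eq:
  assumes "finite K" "\<And>k. k \<notin> K \<Longrightarrow> U k = 0"
  shows "rk_interp h U = lattice_fun K U"
proof
  fix x
  have "rk_interp h U x = (\<Sum>\<^sub>\<infinity>k\<in>K. rk_basis h k x *\<^sub>R U k)"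
    unfolding rk_interp_def by (rule infsum_cong_neutral) (use assms in auto)
  then show "rk_interp h U x = lattice_fun K U x"
    using assms by (simp add: lattice_fun_def rk_basis_eq)
qed

lemma test_fun_psi: "test_fun (\<lambda>x. psi (x - a))"
  by (intro test_fun_shift test_fun_tensor test_fun_cubic_spline h_pos)

lemma psi_measurable [measurable]: "psi \<in> borel_measurable borel"
  using test_fun_tensor[OF test_fun_cubic_spline h_pos] by (simp add: test_fun_def)

lemma lattice_fun_measurable [measurable]:
  fixes U :: "int^'n \<Rightarrow> 'b::euclidean_space"
  shows "lattice_fun K U \<in> borel_measurable borel"
  unfolding lattice_fun_def[abs_def] by measurable

lemma lattice_fun_lipschitz:
  "norm (lattice_fun K U (x + s) - lattice_fun K U x) \<le> ((curv + 1) * (\<Sum>k\<in>K. norm (U k))) * norm s"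
proof -
  have "lattice_fun K U (x + s) - lattice_fun K U x =
     (\<Sum>k\<in>K. (psi (x - grid_point h k + s) - psi (x - grid_point h k)) *\<^sub>R U k)"
    by (simp add: lattice_fun_def sum_subtractf scaleR_left_diff_distrib algebra_simps)
  also have "norm \<dots> \<le> (\<Sum>k\<in>K. ((curv + 1) * norm s) * norm (U k))"
    by (intro sum_norm_le) (auto intro!: mult_right_mono psi_lipschitz)
  finally show ?thesis by (simp add: sum_distrib_left sum_distrib_right mult_ac)
qed

lemma lattice_fun_second_difference:
  "norm (lattice_fun K U (x + s) + lattice_fun K U (x - s) - 2 *\<^sub>R lattice_fun K U x)
     \<le> (2 * curv * (\<Sum>k\<in>K. norm (U k))) * (norm s)\<^sup>2"
proof -
  have "lattice_fun K U (x + s) + lattice_fun K U (x - s) - 2 *\<^sub>R lattice_fun K U x =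
     (\<Sum>k\<in>K. (psi (x - grid_point h k + s) + psi (x - grid_point h k - s) - 2 * psi (x - grid_point h k)) *\<^sub>R U k)"
    by (simp add: lattice_fun_def sum_subtractf sum.distrib scaleR_sum_right scaleR_left_diff_distrib
        scaleR_left_distrib algebra_simps)
  also have "norm \<dots> \<le> (\<Sum>k\<in>K. (2 * curv * (norm s)\<^sup>2) * norm (U k))"
    by (intro sum_norm_le) (auto intro!: mult_right_mono psi_second_difference)
  finally show ?thesis by (simp add: sum_distrib_left sum_distrib_right mult_ac)
qed

lemma finite_grid_ball: "finite {k. norm (grid_point h k) \<le> R}"
proof (rule finite_subset)
  show "{k. norm (grid_point h k) \<le> R} \<subseteq> {k. \<forall>i. k $ i \<in> {- \<lceil>R / h $ i\<rceil>..\<lceil>R / h $ i\<rceil>}}"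
  proof safe
    fix k :: "int^'n" and i
    assume "norm (grid_point h k) \<le> R"
    then have "\<bar>of_int (k $ i) * h $ i\<bar> \<le> R"
      using component_le_norm_cart[of "grid_point h k" i] by (simp add: grid_point_def)
    then have "\<bar>of_int (k $ i)\<bar> \<le> R / h $ i"
      using h_pos[of i] by (simp add: abs_mult field_simps)
    then have "of_int (k $ i) \<le> R / h $ i" "of_int (- (k $ i)) \<le> R / h $ i" by auto
    then have "k $ i \<le> \<lceil>R / h $ i\<rceil>" "- (k $ i) \<le> \<lceil>R / h $ i\<rceil>"
      by (meson le_of_int_ceiling of_int_le_iff order_trans)+
    then show "k $ i \<in> {- \<lceil>R / h $ i\<rceil>..\<lceil>R / h $ i\<rceil>}" by simp
  qed
qed (rule finite_vec_box, simp)

text \<open>The dual argument for cubic splines. It serves the residual, whose discrete norm is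
  thereby bounded below by its grid values.\<close>

lemma lattice_fun_lower:
  fixes F :: "int^'n \<Rightarrow> 'b::euclidean_space"
  assumes "finite K"
  shows "cell h * (\<Sum>k\<in>K. (norm (F k))\<^sup>2) \<le> 576 ^ CARD('n) * (LINT x|lborel. (norm (lattice_fun K F x))\<^sup>2)"
  unfolding lattice_fun_def
proof (rule riesz_lower_bound[OF assms, where g = "\<lambda>k x. tensor h spline_dual (x - grid_point h k)"])
  show "(LINT x|lborel. psi (x - grid_point h j) * tensor h spline_dual (x - grid_point h k)) = (if j = k then cell h else 0)" for j k
    by (subst tensor_lattice_inner[OF test_fun_cubic_spline test_fun_spline_dual h_pos spline_dual_duality]) simp
  show "(LINT x|lborel. tensor h spline_dual (x - grid_point h j) * tensor h spline_dual (x - grid_point h k)) = (if j = k then cell h * 576 ^ CARD('n) else 0)" for j k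
    by (rule tensor_lattice_inner[OF test_fun_spline_dual test_fun_spline_dual h_pos spline_dual_orthogonal])
qed (auto intro!: test_fun_psi test_fun_shift test_fun_tensor test_fun_spline_dual h_pos)

text \<open>In each coordinate both centres lie at distance less than 2 from the rescaled point,
  hence less than 4 from each other; being integers apart, at most 3.\<close>

lemma psi_overlap:
  assumes "psi (x - grid_point h j) * psi (x - grid_point h k) \<noteq> 0"
  shows "j - k \<in> {m. \<forall>i. m $ i \<in> {-3..3}}"
proof safe
  fix i
  have b: "\<bar>x $ i / h $ i - of_int (l $ i)\<bar> < 2" if "psi (x - grid_point h l) \<noteq> 0" for l
  proof (rule ccontr)
    assume "\<not> ?thesis"
    then have "cubic_spline ((x - grid_point h l) $ i / h $ i) = 0"
      by (intro cubic_spline_zero) (simp add: grid_point_def diff_divide_distrib)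
    then have "psi (x - grid_point h l) = 0"
      unfolding tensor_def by (intro prod_zero) (simp, blast)
    then show False using that by simp
  qed
  have "\<bar>of_int ((j - k) $ i)\<bar> < (4::real)"
    using b[of j] b[of k] assms by simp
  then show "(j - k) $ i \<in> {-3..3}" by (simp add: abs_less_iff)
qed

text \<open>A Schur test: at every point only pairs of indices with difference in a fixed box
  contribute, so splitting products by 2 a b \<le> a^2 + b^2 counts each square at most as often as
  the box has elements. What remains are the norms of single basis functions.\<close>

lemma lattice_fun_upper:
  fixes U :: "int^'n \<Rightarrow> 'b::euclidean_space"
  assumes K: "finite K"
  shows "(LINT x|lborel. (norm (lattice_fun K U x))\<^sup>2) \<le>
    real (card {m::int^'n. \<forall>i. m $ i \<in> {-3..3}}) * (LINT t|lborel. (cubic_spline t)\<^sup>2) ^ CARD('n) * cell h * (\<Sum>k\<in>K. (norm (U k))\<^sup>2)"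
proof -
  let ?B = "{m::int^'n. \<forall>i. m $ i \<in> {-3..3}}"
  let ?N = "real (card ?B)"
  have B: "finite ?B" by (rule finite_vec_box) simp
  let ?p = "\<lambda>k x. psi (x - grid_point h k)"
  have pt: "(norm (lattice_fun K U x))\<^sup>2 \<le> (\<Sum>k\<in>K. (?N * (norm (U k))\<^sup>2) * (?p k x * ?p k x))" for x
  proof -
    define a where "a k = \<bar>?p k x\<bar> * norm (U k)" for k
    define e where "e j k = (if j - k \<in> ?B then 1 else 0 :: real)" for j k
    have "(norm (lattice_fun K U x))\<^sup>2 \<le> (\<Sum>k\<in>K. a k)\<^sup>2"
      unfolding lattice_fun_def a_def by (intro power_mono sum_norm_le) auto
    also have "\<dots> = (\<Sum>j\<in>K. \<Sum>k\<in>K. a j * a k)" by (simp add: power2_eq_square sum_product)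
    also have "\<dots> \<le> (\<Sum>j\<in>K. \<Sum>k\<in>K. e j k * (a j)\<^sup>2 / 2 + e j k * (a k)\<^sup>2 / 2)"
    proof (intro sum_mono)
      fix j k
      show "a j * a k \<le> e j k * (a j)\<^sup>2 / 2 + e j k * (a k)\<^sup>2 / 2"
      proof (cases "j - k \<in> ?B")
        case True
        then show ?thesis using sum_squares_bound[of "a j" "a k"] by (simp add: e_def)
      next
        case False
        then have "?p j x * ?p k x = 0" using psi_overlap by blast
        then have "a j * a k = 0" by (auto simp: a_def)
        moreover have "e j k = 0" using False by (simp only: e_def if_False)
        ultimately show ?thesis by auto
      qed
    qed
    also have "\<dots> = (\<Sum>j\<in>K. \<Sum>k\<in>K. e j k * (a j)\<^sup>2 / 2) + (\<Sum>k\<in>K. \<Sum>j\<in>K. e j k * (a k)\<^sup>2 / 2)"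
      by (subst (2) sum.swap) (simp add: sum.distrib)
    also have "\<dots> \<le> (\<Sum>j\<in>K. ?N * (a j)\<^sup>2 / 2) + (\<Sum>k\<in>K. ?N * (a k)\<^sup>2 / 2)"
    proof (intro add_mono sum_mono)
      fix j
      have "(\<Sum>k\<in>K. e j k) = real (card {k\<in>K. j - k \<in> ?B})"
        using K by (simp add: e_def sum.If_cases Int_def)
      also have "card {k\<in>K. j - k \<in> ?B} \<le> card ?B"
        by (intro card_inj_on_le[of "\<lambda>k. j - k"] B) (auto intro: inj_onI)
      finally have "(\<Sum>k\<in>K. e j k) \<le> ?N" by simp
      then have "(\<Sum>k\<in>K. e j k) * ((a j)\<^sup>2 / 2) \<le> ?N * ((a j)\<^sup>2 / 2)" by (intro mult_right_mono) auto
      then show "(\<Sum>k\<in>K. e j k * (a j)\<^sup>2 / 2) \<le> ?N * (a j)\<^sup>2 / 2"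
        unfolding sum_distrib_right unfolding times_divide_eq_right .
    next
      fix k
      have "(\<Sum>j\<in>K. e j k) = real (card {j\<in>K. j - k \<in> ?B})"
        using K by (simp add: e_def sum.If_cases Int_def)
      also have "card {j\<in>K. j - k \<in> ?B} \<le> card ?B"
        by (intro card_inj_on_le[of "\<lambda>j. j - k"] B) (auto intro: inj_onI)
      finally have "(\<Sum>j\<in>K. e j k) \<le> ?N" by simp
      then have "(\<Sum>j\<in>K. e j k) * ((a k)\<^sup>2 / 2) \<le> ?N * ((a k)\<^sup>2 / 2)" by (intro mult_right_mono) auto
      then show "(\<Sum>j\<in>K. e j k * (a k)\<^sup>2 / 2) \<le> ?N * (a k)\<^sup>2 / 2"
        unfolding sum_distrib_right unfolding times_divide_eq_right .
    qed
    also have "\<dots> = (\<Sum>k\<in>K. (?N * (norm (U k))\<^sup>2) * (?p k x * ?p k x))"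
      by (simp add: a_def power_mult_distrib power2_eq_square mult_ac flip: sum.distrib)
    finally show ?thesis .
  qed
  have i: "integrable lborel (\<lambda>x. ?p k x * ?p k x)" for k
    by (intro test_fun_integrable test_fun_mult test_fun_psi)
  have v: "(LINT x|lborel. ?p k x * ?p k x) = cell h * (LINT t|lborel. (cubic_spline t)\<^sup>2) ^ CARD('n)" for k
    unfolding tensor_inner[OF test_fun_cubic_spline test_fun_cubic_spline h_pos]
    by (subst LINT_shift) (simp add: power2_eq_square)
  have I: "integrable lborel (\<lambda>x. \<Sum>k\<in>K. (?N * (norm (U k))\<^sup>2) * (?p k x * ?p k x))"
    by (intro Bochner_Integration.integrable_sum integrable_mult_right i)
  have "(LINT x|lborel. (norm (lattice_fun K U x))\<^sup>2) \<le> (LINT x|lborel. (\<Sum>k\<in>K. (?N * (norm (U k))\<^sup>2) * (?p k x * ?p k x)))"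
  proof (rule integral_mono[OF _ I pt])
    show "integrable lborel (\<lambda>x. (norm (lattice_fun K U x))\<^sup>2)"
      by (rule Bochner_Integration.integrable_bound[OF I])
        (use pt in \<open>auto intro: order_trans[OF _ abs_ge_self]\<close>)
  qed
  also have "\<dots> = (\<Sum>k\<in>K. (?N * (norm (U k))\<^sup>2) * (LINT x|lborel. ?p k x * ?p k x))"
    by (simp only: Bochner_Integration.integral_sum integrable_mult_right i integral_mult_right_zero)
  also have "\<dots> = ?N * (LINT t|lborel. (cubic_spline t)\<^sup>2) ^ CARD('n) * cell h * (\<Sum>k\<in>K. (norm (U k))\<^sup>2)"
    unfolding v by (simp add: sum_distrib_left sum_distrib_right mult_ac)
  finally show ?thesis .
qed

end

section \<open>Nonlocal operators on spline functions and their quadratic forms\<close>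

locale grid_kernel = grid h + kernel \<rho> "TYPE('n)" for h :: "real^'n" and \<rho> +
  fixes \<delta> :: real
  assumes \<delta>_pos: "0 < \<delta>"
begin

lemmas ker_\<delta>_measurable [measurable] = ker_measurable[OF \<delta>_pos]

text \<open>The nonlocal gradient of \<open>psi\<close>; its values at grid differences are the
  coefficients common to \<open>nl_div\<close> and \<open>nl_grad\<close>.\<close>

definition dpsi :: "real^'n \<Rightarrow> real^'n" where
  "dpsi y = (LINT s|lborel. (ker \<delta> s * (psi (y + s) - psi y)) *\<^sub>R s)"

lemma dpsi_integrable: "integrable lborel (\<lambda>s. (ker \<delta> s * (psi (y + s) - psi y)) *\<^sub>R s)"
proof (rule ker_dominated[OF \<delta>_pos])
  show "norm ((ker \<delta> s * (psi (y + s) - psi y)) *\<^sub>R s) \<le> (curv + 1) * \<bar>ker \<delta> s * (norm s)\<^sup>2\<bar>" for s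
    using mult_left_mono[OF psi_lipschitz[of y s], of "\<bar>ker \<delta> s\<bar> * norm s"]
    by (simp add: abs_mult power2_eq_square mult_ac)
qed measurable

lemma dpsi_minus: "dpsi (- y) = - dpsi y"
proof -
  let ?f = "\<lambda>s. (ker \<delta> s * (psi (- y + s) - psi (- y))) *\<^sub>R s"
  have "dpsi (- y) = (LINT s|lborel. ?f (- s))"
    using lborel_integral_scaleR(2)[of "-1" ?f] by (simp add: dpsi_def)
  also have "(\<lambda>s. ?f (- s)) = (\<lambda>s. - ((ker \<delta> s * (psi (y + s) - psi y)) *\<^sub>R s))"
    using psi_minus[of "y + s" for s] by (simp add: ker_minus psi_minus fun_eq_iff add.commute)
  finally show ?thesis by (simp add: dpsi_def)
qed

text \<open>Finite range of kernel and spline; through it the dilatation has only finitely many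
  nonzero grid values.\<close>

lemma dpsi_zero:
  assumes "\<delta> + 2 * (\<Sum>j\<in>UNIV. h $ j) \<le> norm y" shows "dpsi y = 0"
proof -
  have z: "(ker \<delta> s * (psi (y + s) - psi y)) *\<^sub>R s = 0" for s
  proof (cases "norm s < \<delta>")
    case True
    have "2 * (\<Sum>j\<in>UNIV. h $ j) \<le> norm (y + s)"
      using norm_triangle_ineq2[of y "- s"] assms True by simp
    moreover have "2 * (\<Sum>j\<in>UNIV. h $ j) \<le> norm y" using assms \<delta>_pos by simp
    ultimately show ?thesis by (simp add: psi_zero)
  qed (simp add: ker_def)
  show ?thesis unfolding dpsi_def z by simp
qed

lemma nl_div_lattice_fun:
  "nl_div \<rho> \<delta> (lattice_fun K U) x = (\<Sum>j\<in>K. U j \<bullet> dpsi (x - grid_point h j))"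
proof -
  have "nl_div \<rho> \<delta> (lattice_fun K U) x =
     (LINT s|lborel. ker \<delta> s * (s \<bullet> (lattice_fun K U (x + s) - lattice_fun K U x)))"
    by (simp add: nl_div_def set_lebesgue_integral_def ker_def mult.assoc)
  also have "\<dots> = (LINT s|lborel. (\<Sum>j\<in>K. U j \<bullet> ((ker \<delta> s * (psi (x - grid_point h j + s) - psi (x - grid_point h j))) *\<^sub>R s)))"
  proof (intro Bochner_Integration.integral_cong refl)
    fix s
    have "s \<bullet> (lattice_fun K U (x + s) - lattice_fun K U x) =
       (\<Sum>j\<in>K. (psi (x - grid_point h j + s) - psi (x - grid_point h j)) * (s \<bullet> U j))"
      by (simp add: lattice_fun_def inner_diff_right inner_sum_right sum_subtractf algebra_simps)
    then show "ker \<delta> s * (s \<bullet> (lattice_fun K U (x + s) - lattice_fun K U x)) =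
       (\<Sum>j\<in>K. U j \<bullet> ((ker \<delta> s * (psi (x - grid_point h j + s) - psi (x - grid_point h j))) *\<^sub>R s))"
      by (simp add: sum_distrib_left inner_commute mult_ac)
  qed
  also have "\<dots> = (\<Sum>j\<in>K. U j \<bullet> dpsi (x - grid_point h j))"
    unfolding dpsi_def by (subst Bochner_Integration.integral_sum)
      (simp_all only: integrable_inner_right dpsi_integrable integral_inner_right)
  finally show ?thesis .
qed

lemma nl_grad_lattice_fun:
  "nl_grad \<rho> \<delta> (lattice_fun K \<theta>) x = (\<Sum>j\<in>K. \<theta> j *\<^sub>R dpsi (x - grid_point h j))"
proof -
  have "nl_grad \<rho> \<delta> (lattice_fun K \<theta>) x =
     (LINT s|lborel. (ker \<delta> s * (lattice_fun K \<theta> (x + s) - lattice_fun K \<theta> x)) *\<^sub>R s)"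
    by (simp add: nl_grad_def set_lebesgue_integral_def ker_def mult.assoc)
  also have "\<dots> = (LINT s|lborel. (\<Sum>j\<in>K. \<theta> j *\<^sub>R ((ker \<delta> s * (psi (x - grid_point h j + s) - psi (x - grid_point h j))) *\<^sub>R s)))"
  proof (intro Bochner_Integration.integral_cong refl)
    fix s
    have "lattice_fun K \<theta> (x + s) - lattice_fun K \<theta> x =
       (\<Sum>j\<in>K. (psi (x - grid_point h j + s) - psi (x - grid_point h j)) * \<theta> j)"
      by (simp add: lattice_fun_def sum_subtractf algebra_simps)
    then show "(ker \<delta> s * (lattice_fun K \<theta> (x + s) - lattice_fun K \<theta> x)) *\<^sub>R s =
       (\<Sum>j\<in>K. \<theta> j *\<^sub>R ((ker \<delta> s * (psi (x - grid_point h j + s) - psi (x - grid_point h j))) *\<^sub>R s))"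
      by (simp add: sum_distrib_left scaleR_sum_left mult_ac)
  qed
  also have "\<dots> = (\<Sum>j\<in>K. \<theta> j *\<^sub>R dpsi (x - grid_point h j))"
    unfolding dpsi_def by (subst Bochner_Integration.integral_sum)
      (simp_all only: integrable_scaleR_right dpsi_integrable integral_scaleR_right)
  finally show ?thesis .
qed

text \<open>Interpolating the dilatation is what makes this work: its grid values \<theta> become
  the coefficients to which the gradient is applied. Since \<open>dpsi\<close> is odd, the gradient
  matrix is minus the transpose of the divergence matrix, and the form is minus the sum of the
  squares \<theta>_j^2.\<close>

lemma grad_div_form_nonpos:
  assumes K: "finite K"
  shows "(\<Sum>k\<in>K. U k \<bullet> nl_grad \<rho> \<delta> (rk_proj h (nl_div \<rho> \<delta> (lattice_fun K U))) (grid_point h k)) \<le> 0"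
proof -
  define \<theta> where "\<theta> = grid_restrict h (nl_div \<rho> \<delta> (lattice_fun K U))"
  have \<theta>: "\<theta> j = (\<Sum>k\<in>K. U k \<bullet> dpsi (grid_point h j - grid_point h k))" for j
    by (simp add: \<theta>_def grid_restrict_def nl_div_lattice_fun)
  \<comment> \<open>The dilatation is not cut off at the domain: it spreads beyond \<open>K\<close>
    by the horizon and the spline range, so a larger index set \<open>J\<close> carries it.\<close>
  define R where "R = (\<Sum>k\<in>K. norm (grid_point h k)) + \<delta> + 2 * (\<Sum>j\<in>UNIV. h $ j)"
  define J where "J = {j. norm (grid_point h j) \<le> R}"
  have J: "finite J" unfolding J_def by (rule finite_grid_ball)
  have z: "\<theta> j = 0" if "j \<notin> J" for j
    unfolding \<theta>
  proof (intro sum.neutral ballI)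
    fix k assume "k \<in> K"
    then have "norm (grid_point h k) \<le> (\<Sum>k\<in>K. norm (grid_point h k))"
      using K by (intro member_le_sum) auto
    then have "\<delta> + 2 * (\<Sum>j\<in>UNIV. h $ j) \<le> norm (grid_point h j - grid_point h k)"
      using that norm_triangle_ineq2[of "grid_point h j" "grid_point h k"] by (simp add: J_def R_def)
    then show "U k \<bullet> dpsi (grid_point h j - grid_point h k) = 0" by (simp add: dpsi_zero)
  qed
  have interp: "rk_interp h \<theta> = lattice_fun J \<theta>"
    by (rule rk_interp_eq[OF J]) (rule z)
  have "(\<Sum>k\<in>K. U k \<bullet> nl_grad \<rho> \<delta> (rk_proj h (nl_div \<rho> \<delta> (lattice_fun K U))) (grid_point h k)) =
     (\<Sum>k\<in>K. \<Sum>j\<in>J. \<theta> j * (U k \<bullet> dpsi (grid_point h k - grid_point h j)))"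
    unfolding rk_proj_def \<theta>_def[symmetric] interp nl_grad_lattice_fun
    by (simp add: inner_sum_right)
  also have "\<dots> = (\<Sum>j\<in>J. \<Sum>k\<in>K. \<theta> j * (U k \<bullet> dpsi (grid_point h k - grid_point h j)))"
    by (rule sum.swap)
  also have "\<dots> = (\<Sum>j\<in>J. - (\<theta> j * \<theta> j))"
  proof (intro sum.cong refl)
    fix j
    have "U k \<bullet> dpsi (grid_point h k - grid_point h j) = - (U k \<bullet> dpsi (grid_point h j - grid_point h k))" for k
      using dpsi_minus[of "grid_point h j - grid_point h k"] by simp
    then show "(\<Sum>k\<in>K. \<theta> j * (U k \<bullet> dpsi (grid_point h k - grid_point h j))) = - (\<theta> j * \<theta> j)"
      by (simp add: \<theta>[of j] sum_distrib_left sum_negf)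
  qed
  also have "\<dots> \<le> 0" by (intro sum_nonpos) simp
  finally show ?thesis .
qed

text \<open>The form is disintegrated over bond vectors: for each s it is a weighted autocorrelation
  drop of the scalar sequence s \<bullet> U k, to which the Poincare inequality applies before
  integration.\<close>

lemma bond_form_coercive:
  fixes U :: "int^'n \<Rightarrow> real^'n"
  assumes K: "finite K" and R: "\<And>k. k \<in> K \<Longrightarrow> norm (grid_point h k) \<le> R"
    and D: "2 * R + 2 * (\<Sum>j\<in>UNIV. h $ j) \<le> D" "0 < D"
    and c: "\<And>a. c * (norm a)\<^sup>2 \<le> (LINT s|lborel. ker \<delta> s * (s \<bullet> a)\<^sup>2)"
  shows "c * (\<Sum>k\<in>K. (norm (U k))\<^sup>2) \<le>
    4 ^ CARD('n) * (D + \<delta>)\<^sup>2 * (\<Sum>k\<in>K. - (U k \<bullet> nl_bond \<rho> \<delta> (lattice_fun K U) (grid_point h k)))"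
proof -
  let ?u = "lattice_fun K U"
  define w where "w k s = ?u (grid_point h k + s) + ?u (grid_point h k - s) - 2 *\<^sub>R ?u (grid_point h k)" for k s
  define f where "f k s = (ker \<delta> s * (s \<bullet> w k s) / (2 * (norm s)\<^sup>2)) *\<^sub>R s" for k s
  define Q where "Q s = (\<Sum>k\<in>K. - (U k \<bullet> f k s))" for s
  define A where "A s t = autocorr K (\<lambda>k. s \<bullet> U k) t" for s t
  have fi: "integrable lborel (f k)" and fe: "nl_bond \<rho> \<delta> ?u (grid_point h k) = (LINT s|lborel. f k s)" for k
    using nl_bond_eq[OF \<delta>_pos lattice_fun_measurable lattice_fun_lipschitz lattice_fun_second_difference,
        of K U "grid_point h k"] by (simp_all add: f_def[abs_def] w_def)
  have Qi: "integrable lborel Q" unfolding Q_def by (simp add: fi)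
  have Qe: "(LINT s|lborel. Q s) = (\<Sum>k\<in>K. - (U k \<bullet> nl_bond \<rho> \<delta> ?u (grid_point h k)))"
    unfolding Q_def fe by (simp add: fi)
  \<comment> \<open>Testing with s \<bullet> U k turns point values of the spline function into
    autocorrelations; evenness merges the shifts s and -s, and the resulting 2 cancels the one from
    symmetrization.\<close>
  have Qf: "Q s = ker \<delta> s / (norm s)\<^sup>2 * (A s 0 - A s s)" for s
  proof -
    have u: "s \<bullet> ?u (grid_point h k + t) = (\<Sum>j\<in>K. (s \<bullet> U j) * psi (grid_point h k - grid_point h j + t))" for k t
      by (simp add: lattice_fun_def inner_sum_right algebra_simps)
    define P where "P t = (\<Sum>k\<in>K. (s \<bullet> U k) * (s \<bullet> ?u (grid_point h k + t)))" for t
    have P: "P t = A s t" for t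
      unfolding P_def u A_def autocorr_def by (simp add: sum_distrib_left mult_ac)
    have "(\<Sum>k\<in>K. (s \<bullet> U k) * (s \<bullet> w k s)) = P s + P (- s) - 2 * P 0"
      unfolding P_def sum_distrib_left sum.distrib[symmetric] sum_subtractf[symmetric]
      by (intro sum.cong refl) (simp add: w_def inner_diff_right inner_add_right algebra_simps)
    also have "\<dots> = A s s + A s (- s) - 2 * A s 0" by (simp only: P)
    also have "\<dots> = 2 * (A s s - A s 0)" by (simp add: A_def autocorr_minus)
    finally have sw: "(\<Sum>k\<in>K. (s \<bullet> U k) * (s \<bullet> w k s)) = 2 * (A s s - A s 0)" .
    have "Q s = - (ker \<delta> s / (2 * (norm s)\<^sup>2) * (\<Sum>k\<in>K. (s \<bullet> U k) * (s \<bullet> w k s)))"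
      unfolding Q_def f_def by (simp add: sum_distrib_left sum_divide_distrib sum_negf inner_commute mult_ac)
    then show ?thesis unfolding sw by (simp add: right_diff_distrib diff_divide_distrib)
  qed
  have ki: "integrable lborel (\<lambda>s. ker \<delta> s * (s \<bullet> a)\<^sup>2)" for a
    using ker_inner_integrable[OF \<delta>_pos, of a a] by (simp add: power2_eq_square)
  have pt: "(\<Sum>k\<in>K. ker \<delta> s * (s \<bullet> U k)\<^sup>2) \<le> 4 ^ CARD('n) * (D + \<delta>)\<^sup>2 * Q s" for s
  proof (cases "s = 0 \<or> \<delta> \<le> norm s")
    case True
    then show ?thesis by (auto simp: Qf ker_def)
  next
    case False
    then have s: "0 < norm s" "norm s \<le> \<delta>" "s \<noteq> 0" by auto
    \<comment> \<open>The |s|^2 of the Poincare inequality meets the 1 / |s|^2 of the bond operator,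
      leaving the bare kernel on the left.\<close>
    have "ker \<delta> s / (norm s)\<^sup>2 * ((norm s)\<^sup>2 * (\<Sum>k\<in>K. (s \<bullet> U k)\<^sup>2)) \<le>
       ker \<delta> s / (norm s)\<^sup>2 * (4 ^ CARD('n) * (D + \<delta>)\<^sup>2 * (A s 0 - A s s))"
      unfolding A_def
      by (intro mult_left_mono autocorr_coercive[OF K R D] s) (auto simp: ker_nonneg[OF \<delta>_pos] s)
    then show ?thesis using s by (simp add: Qf sum_distrib_left mult_ac)
  qed
  have "c * (\<Sum>k\<in>K. (norm (U k))\<^sup>2) \<le> (\<Sum>k\<in>K. LINT s|lborel. ker \<delta> s * (s \<bullet> U k)\<^sup>2)"
    unfolding sum_distrib_left by (intro sum_mono c)
  also have "\<dots> = (LINT s|lborel. (\<Sum>k\<in>K. ker \<delta> s * (s \<bullet> U k)\<^sup>2))" by (simp add: ki)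
  also have "\<dots> \<le> (LINT s|lborel. 4 ^ CARD('n) * (D + \<delta>)\<^sup>2 * Q s)"
    by (intro integral_mono pt Bochner_Integration.integrable_sum ki integrable_mult_right Qi)
  also have "\<dots> = 4 ^ CARD('n) * (D + \<delta>)\<^sup>2 * (\<Sum>k\<in>K. - (U k \<bullet> nl_bond \<rho> \<delta> ?u (grid_point h k)))"
    unfolding Qe[symmetric] by simp
  finally show ?thesis .
qed

lemma navier_form_coercive:
  fixes U :: "int^'n \<Rightarrow> real^'n"
  assumes K: "finite K" and R: "\<And>k. k \<in> K \<Longrightarrow> norm (grid_point h k) \<le> R"
    and D: "2 * R + 2 * (\<Sum>j\<in>UNIV. h $ j) \<le> D" "0 < D"
    and c: "\<And>a. c * (norm a)\<^sup>2 \<le> (LINT s|lborel. ker \<delta> s * (s \<bullet> a)\<^sup>2)"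
    and \<mu>: "0 < \<mu>" "\<mu> \<le> lam"
  shows "C_alpha CARD('n) * \<mu> / real CARD('n) * c * (\<Sum>k\<in>K. (norm (U k))\<^sup>2) \<le>
    4 ^ CARD('n) * (D + \<delta>)\<^sup>2 * (\<Sum>k\<in>K. U k \<bullet> (- nl_navier_rk lam \<mu> \<rho> \<delta> h (lattice_fun K U) (grid_point h k)))"
proof -
  let ?a = "C_alpha CARD('n) * \<mu> / real CARD('n)" and ?b = "C_beta CARD('n) * (lam - \<mu>) / real CARD('n)"
  let ?B = "\<Sum>k\<in>K. - (U k \<bullet> nl_bond \<rho> \<delta> (lattice_fun K U) (grid_point h k))"
  let ?G = "\<Sum>k\<in>K. U k \<bullet> nl_grad \<rho> \<delta> (rk_proj h (nl_div \<rho> \<delta> (lattice_fun K U))) (grid_point h k)"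
  let ?m = "4 ^ CARD('n) * (D + \<delta>)\<^sup>2 :: real"
  have a: "0 \<le> ?a" and b: "0 \<le> ?b"
    using \<mu> by (simp_all add: C_alpha_def C_beta_def)
  have "(\<Sum>k\<in>K. U k \<bullet> (- nl_navier_rk lam \<mu> \<rho> \<delta> h (lattice_fun K U) (grid_point h k))) = ?a * ?B - ?b * ?G"
    unfolding sum_distrib_left sum_subtractf[symmetric]
    by (intro sum.cong refl) (simp add: nl_navier_rk_def inner_diff_right inner_add_right)
  moreover have "?a * (c * (\<Sum>k\<in>K. (norm (U k))\<^sup>2)) \<le> ?a * (?m * ?B)"
    by (intro mult_left_mono a bond_form_coercive[OF K R D c])
  moreover have "?b * ?G \<le> 0"
    using b grad_div_form_nonpos[OF K] by (rule mult_nonneg_nonpos)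
  then have "0 \<le> ?m * - (?b * ?G)" by (intro mult_nonneg_nonneg) auto
  ultimately show ?thesis by (simp only: ring_distribs mult_ac)
qed

end

theorem theorem4p1:
  fixes \<Omega> :: "(real^'n) set"
    and \<rho> :: "real \<Rightarrow> real"
    and lam \<mu> \<delta>\<^sub>0 h\<^sub>0 :: real
    and hhat :: "real^'n"
  assumes "CARD('n) \<in> {2, 3}"
    and "open \<Omega>" and "bounded \<Omega>"
    and "\<And>r. 0 < r \<Longrightarrow> 0 \<le> \<rho> r"
    and "\<And>r t. 0 < r \<Longrightarrow> r \<le> t \<Longrightarrow> \<rho> t \<le> \<rho> r"
    and "\<And>r. 1 < r \<Longrightarrow> \<rho> r = 0"
    and "(LINT s:ball (0::real^'n) 1|lborel. \<rho> (norm s) * (norm s)\<^sup>2) = real CARD('n)"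
    and "0 < \<mu>" and "\<mu> \<le> lam"
    and "\<And>j. 0 < hhat $ j" and "Max (range (\<lambda>j. hhat $ j)) = 1"
    and "0 < \<delta>\<^sub>0" and "0 < h\<^sub>0"
  shows "\<exists>C>0. \<forall>\<delta> hmax. 0 < \<delta> \<longrightarrow> \<delta> \<le> \<delta>\<^sub>0 \<longrightarrow> 0 < hmax \<longrightarrow> hmax \<le> h\<^sub>0 \<longrightarrow>
    (\<forall>u \<in> trial_space (hmax *\<^sub>R hhat) \<Omega>.
       discrete_norm (hmax *\<^sub>R hhat)
         (grid_restrict_on (hmax *\<^sub>R hhat) \<Omega> (\<lambda>x. - nl_navier_rk lam \<mu> \<rho> \<delta> (hmax *\<^sub>R hhat) u x))
       \<ge> C * L2_norm u)"
proof -
  interpret kernel \<rho> "TYPE('n)"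
    using assms(4,5,7) by unfold_locales
  obtain c where c: "0 < c" "\<And>\<delta> a. 0 < \<delta> \<Longrightarrow> c * (norm a)\<^sup>2 \<le> (LINT s|lborel. ker \<delta> s * (s \<bullet> a)\<^sup>2)"
    by (rule ker_moment_lower) blast
  obtain R where R: "0 < R" "\<And>x. x \<in> \<Omega> \<Longrightarrow> norm x \<le> R"
    using \<open>bounded \<Omega>\<close> unfolding bounded_pos by blast
  have hhat: "hhat $ j \<le> 1" for j
    using Max_ge[of "range (\<lambda>j. hhat $ j)" "hhat $ j"] assms(11) by simp
  \<comment> \<open>Every h_j is at most \<open>h\<^sub>0\<close>, so this D satisfies the support
    condition of \<open>navier_form_coercive\<close> for all admissible meshes at once.\<close>
  define D where "D = 2 * R + 2 * (real CARD('n) * h\<^sub>0)"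
  define m where "m = 4 ^ CARD('n) * (D + \<delta>\<^sub>0)\<^sup>2"
  define c1 where "c1 = C_alpha CARD('n) * \<mu> / real CARD('n) * c / m"
  \<comment> \<open>The upper constant of \<open>lattice_fun_upper\<close> times the lower one of
    \<open>lattice_fun_lower\<close>; the added 1 keeps the square root away from 0.\<close>
  define P where "P = real (card {m::int^'n. \<forall>i. m $ i \<in> {-3..3}}) * (LINT t|lborel. (cubic_spline t)\<^sup>2) ^ CARD('n) * 576 ^ CARD('n) + 1"
  have D: "0 < D" using R assms(13) by (simp add: D_def add_pos_nonneg)
  have m: "0 < m" using D assms(12) by (simp add: m_def)
  have c1: "0 < c1" using m c assms(8) by (simp add: c1_def C_alpha_def)
  have "0 \<le> (LINT t|lborel. (cubic_spline t)\<^sup>2)" by simp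
  then have P: "1 \<le> P" by (simp add: P_def)
  show ?thesis
  proof (intro exI[of _ "c1 / sqrt P"] conjI allI impI ballI)
    show "0 < c1 / sqrt P" using c1 P by simp
    fix \<delta> hmax :: real and u :: "real^'n \<Rightarrow> real^'n"
    assume \<delta>: "0 < \<delta>" "\<delta> \<le> \<delta>\<^sub>0" and hmax: "0 < hmax" "hmax \<le> h\<^sub>0"
    define h where "h = hmax *\<^sub>R hhat"
    assume "u \<in> trial_space (hmax *\<^sub>R hhat) \<Omega>"
    then obtain U where u: "u = rk_interp h U" and U: "\<And>k. grid_point h k \<notin> \<Omega> \<Longrightarrow> U k = 0"
      unfolding trial_space_def h_def by blast
    interpret grid_kernel h \<rho> \<delta>
      using \<delta> hmax assms(10) by unfold_locales (simp_all add: h_def)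
    define K where "K = {k. grid_point h k \<in> \<Omega>}"
    define F where "F k = - nl_navier_rk lam \<mu> \<rho> \<delta> h u (grid_point h k)" for k
    have K: "finite K" unfolding K_def
      by (rule finite_subset[OF _ finite_grid_ball[of R]]) (use R in auto)
    have u: "u = lattice_fun K U" unfolding u
      by (rule rk_interp_eq[OF K]) (simp add: K_def U)
    have Fr: "grid_restrict_on h \<Omega> (\<lambda>x. - nl_navier_rk lam \<mu> \<rho> \<delta> h u x) = (\<lambda>k. if k \<in> K then F k else 0)"
      by (auto simp: grid_restrict_on_def K_def F_def)
    have F: "rk_interp h (\<lambda>k. if k \<in> K then F k else 0) = lattice_fun K F"
      by (subst rk_interp_eq[OF K]) (auto simp: lattice_fun_def fun_eq_iff intro!: sum.cong)
    let ?SU = "\<Sum>k\<in>K. (norm (U k))\<^sup>2" and ?SF = "\<Sum>k\<in>K. (norm (F k))\<^sup>2"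
    let ?IU = "LINT x|lborel. (norm (lattice_fun K U x))\<^sup>2" and ?IF = "LINT x|lborel. (norm (lattice_fun K F x))\<^sup>2"
    have "2 * R + 2 * (\<Sum>j\<in>UNIV. h $ j) \<le> D"
    proof -
      have "(\<Sum>j\<in>UNIV. h $ j) \<le> (\<Sum>j\<in>(UNIV::'n set). h\<^sub>0)"
      proof (rule sum_mono)
        fix j
        have "hmax * hhat $ j \<le> hmax * 1" using hmax hhat by (intro mult_left_mono) auto
        also have "\<dots> \<le> h\<^sub>0" using hmax by simp
        finally show "h $ j \<le> h\<^sub>0" by (simp add: h_def)
      qed
      then show ?thesis by (simp add: D_def)
    qed
    then have "C_alpha CARD('n) * \<mu> / real CARD('n) * c * ?SU \<le> 4 ^ CARD('n) * (D + \<delta>)\<^sup>2 * (\<Sum>k\<in>K. U k \<bullet> F k)"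
      unfolding F_def u
      by (intro navier_form_coercive[where R = R] K c(2) \<delta> D assms(8,9)) (auto simp: K_def R)
    \<comment> \<open>Replacing \<delta> by \<open>\<delta>\<^sub>0\<close> enlarges the factor only
      if the sum is nonnegative, which the coercivity bound just obtained supplies.\<close>
    also have "\<dots> \<le> m * (\<Sum>k\<in>K. U k \<bullet> F k)"
    proof -
      have "0 \<le> C_alpha CARD('n) * \<mu> / real CARD('n) * c * ?SU"
        using c assms(8) by (simp add: C_alpha_def sum_nonneg)
      with calculation have "0 \<le> 4 ^ CARD('n) * (D + \<delta>)\<^sup>2 * (\<Sum>k\<in>K. U k \<bullet> F k)" by linarith
      moreover have pos: "0 < 4 ^ CARD('n) * (D + \<delta>)\<^sup>2" using D \<delta> by simp
      ultimately have "0 \<le> (\<Sum>k\<in>K. U k \<bullet> F k)"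
        using mult_le_cancel_left_pos[OF pos, of 0 "\<Sum>k\<in>K. U k \<bullet> F k"] by (simp only: mult_zero_right)
      then show ?thesis unfolding m_def using D \<delta>
        by (intro mult_right_mono mult_left_mono power_mono) auto
    qed
    finally have "c1 * ?SU \<le> (\<Sum>k\<in>K. U k \<bullet> F k)"
      using m by (simp add: c1_def field_simps)
    \<comment> \<open>Young's inequality weighted so that exactly half of the left side can be
      absorbed.\<close>
    also have "\<dots> \<le> (\<Sum>k\<in>K. c1 / 2 * (norm (U k))\<^sup>2 + (norm (F k))\<^sup>2 / (2 * c1))"
    proof (rule sum_mono)
      fix k
      have "2 * (c1 * norm (U k)) * norm (F k) \<le> (c1 * norm (U k))\<^sup>2 + (norm (F k))\<^sup>2" by (rule sum_squares_bound)
      then have "norm (U k) * norm (F k) \<le> c1 / 2 * (norm (U k))\<^sup>2 + (norm (F k))\<^sup>2 / (2 * c1)"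
        using c1 by (simp add: field_simps power2_eq_square)
      then show "U k \<bullet> F k \<le> c1 / 2 * (norm (U k))\<^sup>2 + (norm (F k))\<^sup>2 / (2 * c1)"
        using norm_cauchy_schwarz[of "U k" "F k"] by linarith
    qed
    also have "\<dots> = c1 / 2 * ?SU + ?SF / (2 * c1)"
      by (simp add: sum.distrib sum_distrib_left sum_divide_distrib)
    finally have S: "c1\<^sup>2 * ?SU \<le> ?SF"
      using c1 by (simp add: field_simps power2_eq_square)
    \<comment> \<open>The upper comparison is used for \<open>U\<close> and the lower one for
      \<open>F\<close>; the cell volume occurs in both and cancels, so the return to L2 norms costs
      only \<open>P\<close>.\<close>
    have "c1\<^sup>2 * ?IU \<le> c1\<^sup>2 * ((P - 1) / 576 ^ CARD('n) * cell h * ?SU)"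
      using lattice_fun_upper[OF K, of U] by (intro mult_left_mono) (simp_all add: P_def)
    also have "\<dots> = (P - 1) / 576 ^ CARD('n) * (cell h * (c1\<^sup>2 * ?SU))" by simp
    also have "\<dots> \<le> (P - 1) / 576 ^ CARD('n) * (576 ^ CARD('n) * ?IF)"
    proof (rule mult_left_mono)
      have "cell h * (c1\<^sup>2 * ?SU) \<le> cell h * ?SF" using S cell_pos by simp
      then show "cell h * (c1\<^sup>2 * ?SU) \<le> 576 ^ CARD('n) * ?IF" using lattice_fun_lower[OF K, of F] by linarith
    qed (use P in simp)
    also have "\<dots> = (P - 1) * ?IF" by simp
    also have "\<dots> \<le> P * ?IF" by (intro mult_right_mono) auto
    finally have "sqrt (c1\<^sup>2 * ?IU) \<le> sqrt (P * ?IF)" by simp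
    then have "c1 * sqrt ?IU \<le> sqrt P * sqrt ?IF" using c1 by (simp add: real_sqrt_mult)
    then have "c1 / sqrt P * L2_norm u \<le> L2_norm (lattice_fun K F)"
      using P by (simp add: L2_norm_def u field_simps)
    then show "c1 / sqrt P * L2_norm u \<le> discrete_norm (hmax *\<^sub>R hhat)
         (grid_restrict_on (hmax *\<^sub>R hhat) \<Omega> (\<lambda>x. - nl_navier_rk lam \<mu> \<rho> \<delta> (hmax *\<^sub>R hhat) u x))"
      by (simp only: h_def[symmetric] discrete_norm_def Fr F)
  qed
qed

end
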